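(* Let $s$ be a function of locally bounded variation on $\mathbb{R}$ with $s(x)=0$ for $x<0$. Suppose that for each $y>0$ the integral $\mathcal{L}\{\mathrm{d}s;y\}:=\int_0^\infty e^{-yx}\,\mathrm{d}s(x)$ exists in the $(\mathrm{C})$ sense. Assume furthermore that there exist $A,B>0$ such that $s(x)+A\log x$ is non-decreasing on $[B,\infty)$. Let $a,b$ be constants. Then $$\mathcal{L}\{\mathrm{d}s;y\}=a+b\log\left(\frac{1}{y}\right)+o(1),\qquad y\to0^+,$$ if and only if $$s(x)=s(0)+a+b\gamma+b\log x+o(1),\qquad x\to\infty,$$ where $\gamma$ is Euler's constant.
   Context: Stieltjes integrals $\int_0^x\varphi(t)\,\mathrm{d}s(t)$ are taken over $[0,x]$ with $s(0)$ as the initial value, so that $\int_0^x\mathrm{d}s(t)=s(x)-s(0)$. For a function $G$ vanishing on $(-\infty,0)$ and an integer $k\geq1$, let $G^{(-k)}(x)=\frac{1}{(k-1)!}\int_0^x(x-t)^{k-1}G(t)\,dt$ ($G^{(0)}=G$); $G$ has limit $\ell$ in the sense $(\mathrm{C},k)$ if $G^{(-k)}(x)=\ell x^k/k!+o(x^k)$ as $x\to\infty$, and "$(\mathrm{C})$" means $(\mathrm{C},k)$ for some $k$ (which may depend on $y$). The integral $\int_0^\infty e^{-yx}\mathrm{d}s(x)$ exists in the $(\mathrm{C})$ sense, with value $\mathcal{L}\{\mathrm{d}s;y\}$, if the function $x\mapsto\int_0^x e^{-yt}\,\mathrm{d}s(t)$ ($x\geq0$, extended by $0$ for $x<0$) has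 a $(\mathrm{C})$ limit as $x\to\infty$. *)

theory Defs
  imports "HOL-Analysis.Analysis" "HOL-Library.Landau_Symbols"
begin

definition is_partition :: "real \<Rightarrow> real \<Rightarrow> nat \<Rightarrow> (nat \<Rightarrow> real) \<Rightarrow> bool" where
  "is_partition a b n p \<longleftrightarrow> p 0 = a \<and> p n = b \<and> (\<forall>i<n. p i < p (Suc i))"

definition bounded_variation_on :: "(real \<Rightarrow> real) \<Rightarrow> real \<Rightarrow> real \<Rightarrow> bool" where
  "bounded_variation_on s a b \<longleftrightarrow>
     (\<exists>M. \<forall>n p. is_partition a b n p \<longrightarrow> (\<Sum>i<n. \<bar>s (p (Suc i)) - s (p i)\<bar>) \<le> M)"

definition locally_bounded_variation :: "(real \<Rightarrow> real) \<Rightarrow> bool" where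
  "locally_bounded_variation s \<longleftrightarrow> (\<forall>a b. a \<le> b \<longrightarrow> bounded_variation_on s a b)"

text \<open>Riemann--Stieltjes integral of phi with respect to s over [a,b] (limit of
  Riemann--Stieltjes sums as the mesh tends to 0).  Over [0,x], the integral of 1 is
  s(x) - s(0), matching the convention that s(0) is the initial value.\<close>
definition has_RS_integral :: "(real \<Rightarrow> real) \<Rightarrow> (real \<Rightarrow> real) \<Rightarrow> real \<Rightarrow> real \<Rightarrow> real \<Rightarrow> bool" where
  "has_RS_integral \<phi> s a b I \<longleftrightarrow>
     (\<forall>\<epsilon>>0. \<exists>\<delta>>0. \<forall>n p \<xi>.
        is_partition a b n p \<and> (\<forall>i<n. p i \<le> \<xi> i \<and> \<xi> i \<le> p (Suc i)) \<and>
        (\<forall>i<n. p (Suc i) - p i < \<delta>) \<longrightarrow>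
        \<bar>(\<Sum>i<n. \<phi> (\<xi> i) * (s (p (Suc i)) - s (p i))) - I\<bar> < \<epsilon>)"

definition RS_integral :: "(real \<Rightarrow> real) \<Rightarrow> (real \<Rightarrow> real) \<Rightarrow> real \<Rightarrow> real \<Rightarrow> real" where
  "RS_integral \<phi> s a b = (THE I. has_RS_integral \<phi> s a b I)"

text \<open>k-fold integral G^(-k) of a function G vanishing on (-inf,0); G^(0) = G.\<close>
definition iter_integral :: "(real \<Rightarrow> real) \<Rightarrow> nat \<Rightarrow> real \<Rightarrow> real" where
  "iter_integral G k x =
     (if k = 0 then G x
      else integral {0..x} (\<lambda>t. (x - t) ^ (k - 1) * G t) / fact (k - 1))"

definition cesaro_lim :: "(real \<Rightarrow> real) \<Rightarrow> nat \<Rightarrow> real \<Rightarrow> bool" where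
  "cesaro_lim G k l \<longleftrightarrow>
     (\<lambda>x. iter_integral G k x - l * x ^ k / fact k) \<in> o[at_top](\<lambda>x. x ^ k)"

definition partial_laplace :: "(real \<Rightarrow> real) \<Rightarrow> real \<Rightarrow> real \<Rightarrow> real" where
  "partial_laplace s y x = (if x < 0 then 0 else RS_integral (\<lambda>t. exp (- y * t)) s 0 x)"

definition laplace_C :: "(real \<Rightarrow> real) \<Rightarrow> real \<Rightarrow> real \<Rightarrow> bool" where
  "laplace_C s y l \<longleftrightarrow> (\<exists>k. cesaro_lim (partial_laplace s y) k l)"

end

theory Submission
  imports Defs "HOL-Probability.Probability" "HOL-Real_Asymp.Real_Asymp"
begin

text \<open>Write \<open>s0 = s - s 0\<close>. Integration by parts turns the partial Laplace integrals into
  \<open>exp (- y * x) * s0 x + y * \<integral>\<^sub>0\<^sup>x s0 t * exp (- y * t) dt\<close>. Adding the same expression for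
  \<open>A * ln\<close>, which converges, gives a nondecreasing function of \<open>x\<close>, and a nondecreasing function
  with a Cesaro limit is bounded. Hence \<open>s0\<close> grows slower than every exponential, the Laplace integral
  converges in the ordinary sense, and \<open>L (1 / x)\<close> is the Abel mean \<open>E (s0 (x * u))\<close> for an
  exponentially distributed \<open>u\<close>. Since \<open>E (ln u) = - euler_mascheroni\<close>, the theorem says that the
  remainder \<open>f t = s0 t - c - b * ln t\<close> tends to \<open>0\<close> iff its Abel mean does.
  One direction is dominated convergence. For the other, \<open>f\<close> is slowly decreasing; comparing the Abel
  means at \<open>x\<close> and \<open>x / 2\<close> bounds \<open>f (2 * x) - f x\<close>, whence \<open>f\<close> is bounded. By
  Weierstrass approximation the kernel \<open>exp (- u)\<close> can then be replaced by a narrow bump, on which a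
  slowly decreasing function is almost constant from either side (Karamata's method).\<close>

section \<open>The exponential distribution\<close>

text \<open>The exponential law of rate one. The density is cut off to the open half-line, so that
  \<open>0 < u\<close> almost everywhere and the values of \<open>ln u\<close> and
  \<open>u powr h\<close> at \<open>0\<close> never matter; it differs from
  \<open>exponential_density 1\<close> only at the point \<open>0\<close>.\<close>

definition exp_measure :: "real measure" where
  "exp_measure = density lborel (\<lambda>u. ennreal (indicator {0<..} u * exp (- u)))"

lemma sets_exp_measure [simp, measurable_cong]: "sets exp_measure = sets borel"
  by (simp add: exp_measure_def)

lemma space_exp_measure [simp]: "space exp_measure = UNIV"
  by (simp add: exp_measure_def)

lemma AE_exp_measure_pos: "AE u in exp_measure. 0 < u"
  unfolding exp_measure_def by (subst AE_density) (auto simp: indicator_def)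

lemma prob_space_exp_measure: "prob_space exp_measure"
proof -
  have "exp_measure = density lborel (exponential_density 1)"
    unfolding exp_measure_def
  proof (intro density_cong)
    have "AE u::real in lborel. u \<noteq> 0"
      by (rule AE_lborel_singleton)
    then show "AE u in lborel. ennreal (indicator {0<..} u * exp (- u)) = exponential_density 1 u"
      by eventually_elim (auto simp: exponential_density_def indicator_def)
  qed auto
  then show ?thesis
    using prob_space_exponential_density[of 1] by simp
qed

interpretation exp_measure: prob_space exp_measure
  by (rule prob_space_exp_measure)

lemma measure_exp_measure_UNIV: "measure exp_measure UNIV = 1"
  using exp_measure.prob_space by simp

lemma integrable_exp_measure_iff:
  assumes [measurable]: "g \<in> borel_measurable borel"
  shows "integrable exp_measure g \<longleftrightarrow> set_integrable lborel {0<..} (\<lambda>u::real. g u * exp (- u) :: real)"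
  unfolding exp_measure_def set_integrable_def
  by (subst integrable_density) (auto simp: mult_ac)

lemma integral_exp_measure:
  assumes [measurable]: "g \<in> borel_measurable borel"
  shows "integral\<^sup>L exp_measure g = (LINT u:{0<..}|lborel. g u * exp (- u) :: real)"
  unfolding exp_measure_def set_lebesgue_integral_def
  by (subst integral_density) (auto simp: mult_ac)

text \<open>Substitution \<open>t = u / c\<close>. This is the bridge between Laplace integrals with
  parameter \<open>c\<close> and expectations of dilated functions.\<close>

lemma exp_measure_scale:
  fixes g :: "real \<Rightarrow> real"
  assumes [measurable]: "g \<in> borel_measurable borel" and c: "c > 0"
  shows "set_integrable lborel {0<..} (\<lambda>t. g t * exp (- c * t)) \<longleftrightarrow>
           integrable exp_measure (\<lambda>u. g (u / c))" (is ?A)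
    and "(LINT t:{0<..}|lborel. g t * exp (- c * t)) = (\<integral>u. g (u / c) \<partial>exp_measure) / c" (is ?B)
proof -
  have ind: "indicator {0<..} (u / c) = (indicator {0<..} u :: real)" for u
    using c by (auto simp: indicator_def zero_less_divide_iff)
  show ?A
    using lborel_integrable_real_affine_iff[of "1 / c" "\<lambda>t. indicator {0<..} t * (g t * exp (- c * t))" 0] c
    by (subst integrable_exp_measure_iff) (auto simp: set_integrable_def ind)
  show ?B
    using lborel_integral_real_affine[of "1 / c" "\<lambda>t. indicator {0<..} t * (g t * exp (- c * t))" 0] c
    by (subst integral_exp_measure) (auto simp: set_lebesgue_integral_def ind)
qed

text \<open>The weight \<open>exp (- (c - 1) * u)\<close> turns the density of rate one into one of
  rate \<open>c\<close>, which amounts to a dilation. Natural \<open>c\<close> serves the powers of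
  \<open>exp (- u)\<close>, and \<open>c = 1/2\<close> gives the exponential moment
  \<open>exp (u / 2)\<close>.\<close>

lemma exp_measure_dilate:
  fixes g :: "real \<Rightarrow> real"
  assumes [measurable]: "g \<in> borel_measurable borel" and c: "c > 0"
  shows "integrable exp_measure (\<lambda>u. g u * exp (- (c - 1) * u)) \<longleftrightarrow>
           integrable exp_measure (\<lambda>u. g (u / c))"
    and "(\<integral>u. g u * exp (- (c - 1) * u) \<partial>exp_measure) = (\<integral>u. g (u / c) \<partial>exp_measure) / c"
proof -
  have eq: "g u * exp (- (c - 1) * u) * exp (- u) = g u * exp (- c * u)" for u
    by (simp add: algebra_simps flip: exp_add)
  show "integrable exp_measure (\<lambda>u. g u * exp (- (c - 1) * u)) \<longleftrightarrow>
           integrable exp_measure (\<lambda>u. g (u / c))"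
    using exp_measure_scale(1)[OF assms]
    by (subst integrable_exp_measure_iff) (auto simp only: eq, measurable)
  show "(\<integral>u. g u * exp (- (c - 1) * u) \<partial>exp_measure) = (\<integral>u. g (u / c) \<partial>exp_measure) / c"
    using exp_measure_scale(2)[OF assms]
    by (subst integral_exp_measure) (auto simp only: eq, measurable)
qed

lemma integrable_exp_half: "integrable exp_measure (\<lambda>u. exp (u / 2))"
  using exp_measure_dilate(1)[of "\<lambda>_. 1" "1/2"] by simp

text \<open>Euler's integral for \<open>Gamma\<close>, read as a nonnegative integral so that
  integrability and value come out together.\<close>

lemma
  assumes "h > -1"
  shows integrable_exp_measure_powr: "integrable exp_measure (\<lambda>u. u powr h)"
    and integral_exp_measure_powr: "(\<integral>u. u powr h \<partial>exp_measure) = Gamma (1 + h)"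
proof -
  have *: "((\<lambda>t. t powr h * exp (- t)) has_integral Gamma (1 + h)) {0..}"
    using Gamma_integral_real[of "1 + h"] assms by (simp add: exp_minus field_simps)
  have nn: "(\<integral>\<^sup>+ u. ennreal (u powr h) \<partial>exp_measure) = ennreal (Gamma (1 + h))"
  proof -
    have "(\<integral>\<^sup>+ u. ennreal (u powr h) \<partial>exp_measure)
        = (\<integral>\<^sup>+ u. ennreal (indicator {0<..} u * exp (- u)) * ennreal (u powr h) \<partial>lborel)"
      unfolding exp_measure_def by (subst nn_integral_density) auto
    also have "\<dots> = (\<integral>\<^sup>+ u. ennreal (indicator {0..} u * (u powr h * exp (- u))) \<partial>lborel)"
      by (intro nn_integral_cong) (auto simp: indicator_def ennreal_mult' mult_ac)
    also have "\<dots> = ennreal (Gamma (1 + h))"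
      by (rule nn_integral_has_integral_lborel)
         (use has_integral_restrict_UNIV[THEN iffD2, OF *] in
           \<open>auto simp: indicator_def elim: has_integral_eq[rotated]\<close>)
    finally show ?thesis .
  qed
  have "Gamma (1 + h) > 0"
    using assms by (intro Gamma_real_pos) auto
  then show "integrable exp_measure (\<lambda>u. u powr h)"
    using nn by (intro integrableI_nonneg) auto
  show "(\<integral>u. u powr h \<partial>exp_measure) = Gamma (1 + h)"
    using nn \<open>Gamma (1 + h) > 0\<close> by (intro integral_eq_nn_integral[THEN trans]) auto
qed

section \<open>The mean of the logarithm under the exponential law\<close>

lemma abs_ln_le_powr:
  fixes u :: real
  assumes "u > 0"
  shows "\<bar>ln u\<bar> \<le> u + 2 * u powr (- 1 / 2)"
proof (cases "u \<ge> 1")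
  case True
  then show ?thesis
    using ln_le_minus_one[of u] powr_ge_zero[of u "- 1 / 2"] assms ln_ge_zero[of u] by linarith
next
  case False
  \<comment> \<open>Applying \<open>ln v \<le> v - 1\<close> to a negative power of \<open>u\<close>
    controls the logarithm near the origin; the exponent \<open>- 1 / 2\<close> is above
    \<open>- 1\<close>, so the bound remains integrable there.\<close>
  have "ln (u powr (- 1 / 2)) \<le> u powr (- 1 / 2) - 1"
    using assms by (intro ln_le_minus_one) auto
  then have "- ln u \<le> 2 * u powr (- 1 / 2)"
    using assms by (simp add: ln_powr)
  then show ?thesis
    using False assms ln_le_zero_iff[of u] by linarith
qed

lemma integrable_exp_measure_abs_ln: "integrable exp_measure (\<lambda>u. \<bar>ln u\<bar>)"
proof (rule Bochner_Integration.integrable_bound)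
  show "integrable exp_measure (\<lambda>u. u powr 1 + 2 * u powr (- 1 / 2))"
    by (intro Bochner_Integration.integrable_add integrable_mult_right integrable_exp_measure_powr) auto
  show "AE u in exp_measure. norm \<bar>ln u\<bar> \<le> norm (u powr 1 + 2 * u powr (- 1 / 2))"
    using AE_exp_measure_pos by eventually_elim (use abs_ln_le_powr in \<open>auto simp: abs_of_nonneg\<close>)
qed auto

lemma integrable_exp_measure_ln: "integrable exp_measure (\<lambda>u. ln u)"
  using integrable_exp_measure_abs_ln by (subst (asm) integrable_abs_iff) auto

text \<open>A dominating function, uniform in \<open>h\<close>, for the difference quotients of
  \<open>u powr h\<close> at \<open>h = 0\<close>. Above one, Young's inequality gives
  \<open>u - 1\<close>; below one, \<open>exp z \<ge> 1 + z\<close> gives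
  \<open>- ln u\<close>.\<close>

lemma powr_quotient_bound:
  fixes u :: real
  assumes u: "u > 0" and h: "0 < h" "h \<le> 1"
  shows "\<bar>(u powr h - 1) / h\<bar> \<le> \<bar>ln u\<bar> + u powr 1"
proof (cases "u \<ge> 1")
  case True
  have "u powr h = (1 + (u - 1)) powr h" by simp
  also have "\<dots> \<le> 1 + h * (u - 1)"
    using h u Youngs_inequality_0[of h "1 - h" u 1] by (simp add: algebra_simps)
  finally have "(u powr h - 1) / h \<le> u - 1"
    using h by (simp add: field_simps)
  moreover have "(u powr h - 1) / h \<ge> 0"
    using h True by (simp add: ge_one_powr_ge_zero)
  ultimately have "\<bar>(u powr h - 1) / h\<bar> \<le> u - 1"
    by linarith
  then show ?thesis using u by simp
next
  case False
  have "1 + h * ln u \<le> u powr h"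
    using u exp_ge_add_one_self[of "h * ln u"] by (simp add: powr_def)
  then have "- ln u \<ge> (1 - u powr h) / h"
    using h by (simp add: field_simps)
  moreover have "u powr h \<le> 1"
    using False u h by (simp add: powr_le1)
  then have "(u powr h - 1) / h \<le> 0"
    using h by (simp add: divide_nonpos_pos)
  ultimately have "\<bar>(u powr h - 1) / h\<bar> \<le> - ln u"
    by (simp add: abs_of_nonpos diff_divide_distrib)
  then show ?thesis
    using u powr_ge_zero[of u 1] by linarith
qed

text \<open>Both sides are the derivative at \<open>h = 0\<close> of the moment
  \<open>Gamma (1 + h)\<close>, taken along \<open>h = 1 / (n + 1)\<close>: under the integral sign
  it is the mean of \<open>ln u\<close>, while the derivative of \<open>Gamma\<close> at
  \<open>1\<close> is \<open>- euler_mascheroni\<close>.\<close>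

lemma integral_exp_measure_ln: "(\<integral>u. ln u \<partial>exp_measure) = - euler_mascheroni"
proof -
  define X where "X n = 1 / real (Suc n)" for n
  have X: "0 < X n" "X n \<le> 1" for n by (auto simp: X_def)
  have X0: "filterlim X (at 0) sequentially"
    using LIMSEQ_inverse_real_of_nat
    by (auto simp: filterlim_at X_def[abs_def] inverse_eq_divide)
  have "(\<lambda>n. \<integral>u. (u powr X n - 1) / X n \<partial>exp_measure) \<longlonglongrightarrow> (\<integral>u. ln u \<partial>exp_measure)"
  proof (rule integral_dominated_convergence)
    show "integrable exp_measure (\<lambda>u. \<bar>ln u\<bar> + u powr 1)"
      by (intro Bochner_Integration.integrable_add integrable_exp_measure_powr integrable_exp_measure_abs_ln) auto
    show "AE u in exp_measure. norm ((u powr X n - 1) / X n) \<le> \<bar>ln u\<bar> + u powr 1" for n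
      using AE_exp_measure_pos by eventually_elim (use powr_quotient_bound[OF _ X] in simp)
    show "AE u in exp_measure. (\<lambda>n. (u powr X n - 1) / X n) \<longlonglongrightarrow> ln u"
      using AE_exp_measure_pos
    proof eventually_elim
      case (elim u)
      have "((\<lambda>h. u powr h) has_field_derivative ln u) (at 0)"
        using elim by (auto intro!: derivative_eq_intros)
      then have "((\<lambda>h. (u powr h - 1) / h) \<longlongrightarrow> ln u) (at 0)"
        using elim by (simp add: DERIV_def)
      then show ?case using X0 by (rule filterlim_compose)
    qed
  qed auto
  moreover have "(\<integral>u. (u powr X n - 1) / X n \<partial>exp_measure) = (Gamma (1 + X n) - 1) / X n" for n
    using X(1)[of n] integrable_exp_measure_powr[of "X n"]
    by (simp add: integral_exp_measure_powr Bochner_Integration.integral_diff measure_exp_measure_UNIV)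
  moreover have "(\<lambda>n. (Gamma (1 + X n) - 1) / X n) \<longlonglongrightarrow> - euler_mascheroni"
  proof -
    have "(Gamma has_field_derivative (- euler_mascheroni :: real)) (at 1)"
      by (auto intro!: derivative_eq_intros elim!: nonpos_Ints_cases)
    then have "((\<lambda>h. (Gamma (1 + h) - 1) / h) \<longlongrightarrow> - euler_mascheroni) (at (0::real))"
      by (simp add: DERIV_def)
    then show ?thesis using X0 by (rule filterlim_compose)
  qed
  ultimately show ?thesis
    by (simp only:) (rule LIMSEQ_unique)
qed

section \<open>A Tauberian theorem for Abel means of slowly decreasing functions\<close>

lemma measure_exp_measure_Icc_pos:
  assumes "0 < p" "p < q"
  shows "0 < measure exp_measure {p..q}"
proof -
  have "ennreal (exp (- q) * (q - p)) = (\<integral>\<^sup>+ u. ennreal (exp (- q)) * indicator {p..q} u \<partial>lborel)"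
    using assms by (subst nn_integral_cmult_indicator) (auto simp: ennreal_mult)
  also have "\<dots> \<le> (\<integral>\<^sup>+ u. ennreal (indicator {0<..} u * exp (- u)) * indicator {p..q} u \<partial>lborel)"
    using assms by (intro nn_integral_mono) (auto simp: indicator_def)
  also have "\<dots> = emeasure exp_measure {p..q}"
    unfolding exp_measure_def by (subst emeasure_density) auto
  finally have "exp (- q) * (q - p) \<le> measure exp_measure {p..q}"
    by (simp add: exp_measure.emeasure_eq_measure)
  moreover have "0 < exp (- q) * (q - p)"
    using assms by simp
  ultimately show ?thesis by linarith
qed

lemma integrable_exp_measure_Icc: "integrable exp_measure (indicat_real {p..q})"
  by (rule exp_measure.integrable_const_bound[where B = 1]) (auto simp: indicator_def)

section \<open>Abel means and subexponential growth\<close>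

definition abel_mean :: "(real \<Rightarrow> real) \<Rightarrow> real \<Rightarrow> real" where
  "abel_mean f x = (\<integral>u. f (x * u) \<partial>exp_measure)"

text \<open>The bound is required on all of \<open>(0, \<infinity>)\<close>, so it includes
  boundedness near the origin. A function with a logarithmic singularity at \<open>0\<close> is
  thereby excluded, which is why the remainder is truncated later.\<close>

definition subexponential :: "(real \<Rightarrow> real) \<Rightarrow> bool" where
  "subexponential f \<longleftrightarrow> (\<forall>y>0. \<exists>C. \<forall>t>0. \<bar>f t\<bar> \<le> C * exp (y * t))"

lemma subexponentialE:
  assumes "subexponential f" "y > 0"
  obtains C where "C \<ge> 0" "\<And>t. t > 0 \<Longrightarrow> \<bar>f t\<bar> \<le> C * exp (y * t)"
proof -
  obtain C where C: "\<And>t. t > 0 \<Longrightarrow> \<bar>f t\<bar> \<le> C * exp (y * t)"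
    using assms unfolding subexponential_def by blast
  moreover have "C \<ge> 0"
    using order.trans[OF abs_ge_zero C[of 1]] by (simp add: zero_le_mult_iff)
  ultimately show ?thesis using that by blast
qed

lemma subexponential_bounded_initial:
  assumes "subexponential f"
  obtains K where "\<And>t. 0 < t \<Longrightarrow> t \<le> X \<Longrightarrow> \<bar>f t\<bar> \<le> K"
proof -
  obtain C where C: "C \<ge> 0" "\<And>t. t > 0 \<Longrightarrow> \<bar>f t\<bar> \<le> C * exp (1 * t)"
    using subexponentialE[OF assms zero_less_one] by blast
  have "\<bar>f t\<bar> \<le> C * exp X" if "0 < t" "t \<le> X" for t
    using C(2)[of t] that mult_left_mono[of "exp t" "exp X" C] C(1) by simp
  then show ?thesis by (rule that)
qed

lemma tendsto_0_at_topE: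
  fixes g :: "real \<Rightarrow> real"
  assumes "(g \<longlongrightarrow> 0) at_top" "e > 0"
  obtains X where "X > 0" "\<And>x. x \<ge> X \<Longrightarrow> \<bar>g x\<bar> < e"
proof -
  obtain X where "\<And>x. x \<ge> X \<Longrightarrow> \<bar>g x\<bar> < e"
    using tendstoD[OF assms] by (auto simp: eventually_at_top_linorder)
  then show ?thesis using that[of "max X 1"] by simp
qed

text \<open>Growth at rate \<open>1 / (2 * x)\<close> dominates \<open>f (x * u)\<close> by a
  multiple of \<open>exp (u / 2)\<close>, which is integrable against the exponential law.\<close>

lemma integrable_subexponential:
  assumes [measurable]: "f \<in> borel_measurable borel" and "subexponential f" and "x > 0"
  shows "integrable exp_measure (\<lambda>u. f (x * u))"
proof -
  obtain C where C: "\<And>t. t > 0 \<Longrightarrow> \<bar>f t\<bar> \<le> C * exp (1 / (2 * x) * t)"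
    using subexponentialE[OF assms(2), of "1 / (2 * x)"] \<open>x > 0\<close> by auto
  show ?thesis
  proof (rule Bochner_Integration.integrable_bound)
    show "integrable exp_measure (\<lambda>u. C * exp (u / 2))"
      by (intro integrable_mult_right integrable_exp_half)
    show "AE u in exp_measure. norm (f (x * u)) \<le> norm (C * exp (u / 2))"
      using AE_exp_measure_pos
    proof eventually_elim
      case (elim u)
      then show ?case
        using C[of "x * u"] \<open>x > 0\<close> by (simp add: order.trans[OF _ abs_ge_self])
    qed
  qed measurable
qed

text \<open>The Abelian direction: \<open>x * u\<close> tends to infinity for almost every
  \<open>u\<close>, and the bound \<open>K\<close> is an integrable dominator on a probability
  space.\<close>

lemma abel_mean_tendsto_0:
  assumes [measurable]: "f \<in> borel_measurable borel"
    and bdd: "\<And>t. t > 0 \<Longrightarrow> \<bar>f t\<bar> \<le> K"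
    and lim: "(f \<longlongrightarrow> 0) at_top"
  shows "(abel_mean f \<longlongrightarrow> 0) at_top"
proof -
  have "((\<lambda>x. \<integral>u. f (x * u) \<partial>exp_measure) \<longlongrightarrow> (\<integral>u. 0 \<partial>exp_measure)) at_top"
  proof (rule integral_dominated_convergence_at_top)
    show "\<forall>\<^sub>F x in at_top. AE u in exp_measure. norm (f (x * u)) \<le> K"
      using eventually_gt_at_top[of 0]
    proof eventually_elim
      case (elim x)
      show ?case
        using AE_exp_measure_pos by eventually_elim (use bdd elim in auto)
    qed
    show "AE u in exp_measure. ((\<lambda>x. f (x * u)) \<longlongrightarrow> 0) at_top"
      using AE_exp_measure_pos
    proof eventually_elim
      case (elim u)
      have "filterlim (\<lambda>x. x * u) at_top at_top"
        using elim by (intro filterlim_tendsto_pos_mult_at_top[OF tendsto_const _ filterlim_ident, of u, unfolded mult.commute[of u]])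
      then show ?case by (rule filterlim_compose[OF lim])
    qed
  qed auto
  then show ?thesis
    unfolding abel_mean_def by simp
qed

text \<open>The condition \<open>slow\<close> says that \<open>f t + A * ln t\<close> is
  nondecreasing on \<open>(0, \<infinity>)\<close>. Written with the quotient \<open>t / x\<close>,
  it is visibly invariant under the dilations that Abel means are built from.\<close>

locale slowly_decreasing =
  fixes f :: "real \<Rightarrow> real" and A :: real
  assumes meas [measurable]: "f \<in> borel_measurable borel"
    and subexp: "subexponential f"
    and A_nonneg: "A \<ge> 0"
    and slow: "\<And>x t. 0 < x \<Longrightarrow> x \<le> t \<Longrightarrow> f x - A * ln (t / x) \<le> f t"
begin

lemma integrable_dilate: "x > 0 \<Longrightarrow> integrable exp_measure (\<lambda>u. f (x * u))"
  by (rule integrable_subexponential[OF meas subexp])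

text \<open>A power of \<open>exp (- u)\<close> only changes the rate of the exponential law, hence
  only rescales the argument of the Abel mean. Every polynomial kernel in \<open>exp (- u)\<close>
  is thus controlled by Abel means.\<close>

lemma
  assumes "x > 0"
  shows integrable_power_kernel: "integrable exp_measure (\<lambda>u. f (x * u) * exp (- u) ^ n)"
    and integral_power_kernel:
      "(\<integral>u. f (x * u) * exp (- u) ^ n \<partial>exp_measure) = abel_mean f (x / real (Suc n)) / real (Suc n)"
proof -
  have *: "exp (- u) ^ n = exp (- (real (Suc n) - 1) * u)" for u :: real
    by (simp add: exp_of_nat_mult[symmetric])
  have **: "f (x * (u / real (Suc n))) = f (x / real (Suc n) * u)" for u
    by (simp add: field_simps)
  show "integrable exp_measure (\<lambda>u. f (x * u) * exp (- u) ^ n)"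
    unfolding * using assms integrable_dilate[of "x / real (Suc n)"]
    by (subst exp_measure_dilate(1)) (auto simp only: **, auto)
  show "(\<integral>u. f (x * u) * exp (- u) ^ n \<partial>exp_measure) = abel_mean f (x / real (Suc n)) / real (Suc n)"
    unfolding * abel_mean_def by (subst exp_measure_dilate(2)) (auto simp only: **, auto)
qed

text \<open>The kernel \<open>1 - 2 * exp (- u)\<close> has mean zero, changes sign only at \<open>ln 2\<close>, and turns
  \<open>f\<close> into a difference of two Abel means. Up to the logarithmic slack the integrand is therefore
  nonnegative, so bounded Abel means force bounded increments \<open>f (2 * z) - f z\<close>.\<close>

lemma kernel_pointwise:
  fixes x u :: real
  defines "c \<equiv> ln 2"
  assumes x: "x > 0" and u: "u > 0" and P: "f (2 * (c * x)) - f (c * x) \<ge> 0"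
  shows "(f (2 * (c * x)) - f (c * x)) / 2 * indicator {2 * c..3 * c} u - A * (\<bar>ln u\<bar> + \<bar>ln c\<bar>)
          \<le> (f (x * u) - f (c * x)) * (1 - 2 * exp (- u))"
proof -
  define P where "P = f (2 * (c * x)) - f (c * x)"
  define k where "k = 1 - 2 * exp (- u)"
  have c: "c > 0" by (simp add: c_def)
  have ec: "exp (- c) = 1 / 2" by (simp add: c_def exp_minus)
  have lnc: "A * \<bar>ln (u / c)\<bar> \<le> A * (\<bar>ln u\<bar> + \<bar>ln c\<bar>)"
    using u c A_nonneg by (intro mult_left_mono) (auto simp: ln_div)
  have "P / 2 * indicator {2 * c..3 * c} u - A * \<bar>ln (u / c)\<bar> \<le> (f (x * u) - f (c * x)) * k"
  \<comment> \<open>Left of the sign change both factors are nonpositive up to the slack: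
    \<open>k\<close> lies in \<open>[-1, 0]\<close> and the increment of \<open>f\<close> is at most
    the slack.\<close>
  proof (cases "u < c")
    case True
    have "exp (- u) \<ge> 1 / 2" "exp (- u) \<le> 1"
      using True u ec by (auto simp flip: ec)
    then have k: "k \<le> 0" "-1 \<le> k" by (auto simp: k_def)
    have "f (x * u) - A * ln (c * x / (x * u)) \<le> f (c * x)"
      using True x u by (intro slow) auto
    moreover have "ln (c * x / (x * u)) = - ln (u / c)" "ln (u / c) \<le> 0"
      using x u c True by (auto simp: ln_div field_simps)
    ultimately have q: "f (x * u) - f (c * x) \<le> A * \<bar>ln (u / c)\<bar>"
      by (simp add: abs_of_nonpos)
    have "A * \<bar>ln (u / c)\<bar> * (-1) \<le> A * \<bar>ln (u / c)\<bar> * k"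
      using k A_nonneg by (intro mult_left_mono) auto
    also have "\<dots> \<le> (f (x * u) - f (c * x)) * k"
      using k q by (intro mult_right_mono_neg) auto
    finally show ?thesis using True c by (simp add: indicator_def)
  next
    case False
    have "exp (- u) \<le> 1 / 2" "exp (- u) \<ge> 0"
      using False u by (auto simp flip: ec)
    then have k: "0 \<le> k" "k \<le> 1" by (auto simp: k_def)
    have ln0: "ln (u / c) \<ge> 0"
      using False c by auto
    have Al: "A * \<bar>ln (u / c)\<bar> * k \<le> A * \<bar>ln (u / c)\<bar>"
      using k A_nonneg by (intro mult_left_le) auto
    show ?thesis
    \<comment> \<open>On this window \<open>f (x * u)\<close> has already gained the increment
      \<open>P\<close> up to slack, and the kernel is at least \<open>1 / 2\<close> because
      \<open>exp (- 2 * c) = 1 / 4\<close>. Elsewhere to the right of \<open>c\<close> only the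
      slack is lost, as \<open>k\<close> is in \<open>[0, 1]\<close>.\<close>
    proof (cases "u \<in> {2 * c..3 * c}")
      case True
      have "f (2 * (c * x)) - A * ln (x * u / (2 * (c * x))) \<le> f (x * u)"
        using True x u c by (intro slow) auto
      moreover have "ln (x * u / (2 * (c * x))) \<le> ln (u / c)"
        using x u c by (subst ln_le_cancel_iff) (auto simp: field_simps)
      then have "A * ln (x * u / (2 * (c * x))) \<le> A * ln (u / c)"
        using A_nonneg by (intro mult_left_mono) auto
      ultimately have q: "P - A * \<bar>ln (u / c)\<bar> \<le> f (x * u) - f (c * x)"
        using ln0 by (simp add: P_def)
      have "exp (- u) \<le> exp (- (2 * c))" using True by simp
      also have "\<dots> = exp (- c) ^ 2" by (simp flip: exp_of_nat_mult)
      finally have "k \<ge> 1 / 2" by (simp add: k_def ec power2_eq_square)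
      then have "P * (1 / 2) \<le> P * k"
        using assms P_def by (intro mult_left_mono) auto
      then have "P / 2 - A * \<bar>ln (u / c)\<bar> \<le> (P - A * \<bar>ln (u / c)\<bar>) * k"
        using Al by (simp add: left_diff_distrib)
      also have "\<dots> \<le> (f (x * u) - f (c * x)) * k"
        using q k by (intro mult_right_mono) auto
      finally show ?thesis using True by simp
    next
      case notin: False
      have "f (c * x) - A * ln (x * u / (c * x)) \<le> f (x * u)"
        using False x u c by (intro slow) auto
      moreover have "x * u / (c * x) = u / c" using x by simp
      ultimately have q: "- (A * \<bar>ln (u / c)\<bar>) \<le> f (x * u) - f (c * x)"
        using ln0 by simp
      have "- (A * \<bar>ln (u / c)\<bar>) \<le> - (A * \<bar>ln (u / c)\<bar>) * k"
        using Al by simp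
      also have "\<dots> \<le> (f (x * u) - f (c * x)) * k"
        using q k by (intro mult_right_mono) auto
      finally show ?thesis using notin by simp
    qed
  qed
  then show ?thesis using lnc unfolding P_def k_def by linarith
qed

text \<open>Integrates the pointwise bound. The constant \<open>f (c * x)\<close> integrates to zero
  against the kernel because \<open>exp (- u)\<close> has mean \<open>1 / 2\<close>; what remains is
  the difference of the Abel means at \<open>x\<close> and \<open>x / 2\<close>. A negative
  increment makes the left side nonpositive, so only the other case needs the kernel.\<close>

lemma doubling_step:
  fixes x :: real
  defines "c \<equiv> ln 2"
  assumes x: "x > 0"
  shows "(f (2 * (c * x)) - f (c * x)) / 2 * measure exp_measure {2 * c..3 * c}
      \<le> A * ((\<integral>u. \<bar>ln u\<bar> \<partial>exp_measure) + \<bar>ln c\<bar>) + \<bar>abel_mean f x - abel_mean f (x / 2)\<bar>"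
proof (cases "f (2 * (c * x)) - f (c * x) \<ge> 0")
  case True
  define P where "P = f (2 * (c * x)) - f (c * x)"
  note [intro] = integrable_exp_measure_abs_ln integrable_exp_measure_Icc
  have i1: "integrable exp_measure (\<lambda>u. f (x * u))"
    using x by (rule integrable_dilate)
  have i2: "integrable exp_measure (\<lambda>u. f (x * u) * exp (- u))"
    using integrable_power_kernel[OF x, of 1] by simp
  have i3: "integrable exp_measure (\<lambda>u::real. exp (- u))"
    using exp_measure_dilate(1)[of "\<lambda>_. 1" 2] by simp
  have v3: "(\<integral>u. exp (- u) \<partial>exp_measure) = 1 / 2"
    using exp_measure_dilate(2)[of "\<lambda>_. 1" 2]
    by (simp add: measure_exp_measure_UNIV)
  have v2: "(\<integral>u. f (x * u) * exp (- u) \<partial>exp_measure) = abel_mean f (x / 2) / 2"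
    using integral_power_kernel[OF x, of 1] by simp
  have eq: "(f (x * u) - f (c * x)) * (1 - 2 * exp (- u))
      = f (x * u) - 2 * (f (x * u) * exp (- u)) - f (c * x) + (2 * f (c * x)) * exp (- u)" for u
    by (simp add: algebra_simps)
  have int: "integrable exp_measure (\<lambda>u. (f (x * u) - f (c * x)) * (1 - 2 * exp (- u)))"
    unfolding eq using i1 i2 i3
    by (intro Bochner_Integration.integrable_add Bochner_Integration.integrable_diff integrable_mult_right) auto
  have val: "(\<integral>u. (f (x * u) - f (c * x)) * (1 - 2 * exp (- u)) \<partial>exp_measure)
      = abel_mean f x - abel_mean f (x / 2)"
    unfolding eq using i1 i2 i3
    by (simp add: v2 v3 measure_exp_measure_UNIV)
       (simp add: abel_mean_def)
  have "P / 2 * measure exp_measure {2 * c..3 * c} - A * ((\<integral>u. \<bar>ln u\<bar> \<partial>exp_measure) + \<bar>ln c\<bar>)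
      = (\<integral>u. P / 2 * indicator {2 * c..3 * c} u - A * (\<bar>ln u\<bar> + \<bar>ln c\<bar>) \<partial>exp_measure)"
  proof (subst Bochner_Integration.integral_diff)
    show "integrable exp_measure (\<lambda>u. A * (\<bar>ln u\<bar> + \<bar>ln c\<bar>))"
      using integrable_exp_measure_abs_ln by simp
  qed (use integrable_exp_measure_abs_ln integrable_exp_measure_Icc in
        \<open>auto simp: measure_exp_measure_UNIV\<close>)
  also have "\<dots> \<le> (\<integral>u. (f (x * u) - f (c * x)) * (1 - 2 * exp (- u)) \<partial>exp_measure)"
  proof (rule integral_mono_AE)
    show "integrable exp_measure (\<lambda>u. P / 2 * indicator {2 * c..3 * c} u - A * (\<bar>ln u\<bar> + \<bar>ln c\<bar>))"
      by (intro Bochner_Integration.integrable_add Bochner_Integration.integrable_diff integrable_mult_right)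
         auto
    show "AE u in exp_measure. P / 2 * indicator {2 * c..3 * c} u - A * (\<bar>ln u\<bar> + \<bar>ln c\<bar>)
        \<le> (f (x * u) - f (c * x)) * (1 - 2 * exp (- u))"
      using AE_exp_measure_pos
      by eventually_elim (use kernel_pointwise[OF x] True in \<open>simp add: P_def c_def\<close>)
  qed (rule int)
  finally show ?thesis
    unfolding val P_def by linarith
next
  case False
  then have "(f (2 * (c * x)) - f (c * x)) / 2 * measure exp_measure {2 * c..3 * c} \<le> 0"
    by (intro mult_nonpos_nonneg) auto
  moreover have "0 \<le> A * ((\<integral>u. \<bar>ln u\<bar> \<partial>exp_measure) + \<bar>ln c\<bar>)"
    using A_nonneg by simp
  ultimately show ?thesis by linarith
qed

lemma doubling_bounded:
  assumes lim: "(abel_mean f \<longlongrightarrow> 0) at_top"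
  obtains D where "D \<ge> 0" "\<And>z. z > 0 \<Longrightarrow> f (2 * z) - f z \<le> D"
proof -
  define c where "c = (ln 2 :: real)"
  define m where "m = measure exp_measure {2 * c..3 * c}"
  define W where "W = A * ((\<integral>u. \<bar>ln u\<bar> \<partial>exp_measure) + \<bar>ln c\<bar>)"
  have c: "c > 0" by (simp add: c_def)
  then have m: "m > 0" unfolding m_def by (intro measure_exp_measure_Icc_pos) auto
  obtain X where X: "X > 0" "\<And>x. x \<ge> X \<Longrightarrow> \<bar>abel_mean f x\<bar> < 1"
    using tendsto_0_at_topE[OF lim zero_less_one] by blast
  \<comment> \<open>If \<open>z = c * x\<close> is at least \<open>Z\<close>, then \<open>x\<close>
    and \<open>x / 2\<close> are both at least \<open>X\<close>, so the two Abel means differ by at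
    most \<open>2\<close>. Below \<open>Z\<close>, the points \<open>z\<close> and
    \<open>2 * z\<close> lie in \<open>(0, 2 * Z]\<close>, where \<open>f\<close> is
    bounded.\<close>
  define Z where "Z = 2 * c * X"
  obtain K where K: "\<And>t. 0 < t \<Longrightarrow> t \<le> 2 * Z \<Longrightarrow> \<bar>f t\<bar> \<le> K"
    using subexponential_bounded_initial[OF subexp] by blast
  have Z: "Z > 0" using c X by (simp add: Z_def)
  have "f (2 * z) - f z \<le> max (2 * (W + 2) / m) (2 * K)" if z: "z > 0" for z
  proof (cases "z \<ge> Z")
    case True
    define x where "x = z / c"
    have zx: "z = c * x" using c by (simp add: x_def)
    have x: "x \<ge> 2 * X" using True c by (simp add: x_def Z_def field_simps)
    have "\<bar>abel_mean f x\<bar> < 1" "\<bar>abel_mean f (x / 2)\<bar> < 1"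
      using x X by auto
    then have "(f (2 * z) - f z) / 2 * m \<le> W + 2"
      using doubling_step[of x] x X unfolding zx W_def m_def c_def by linarith
    then have "f (2 * z) - f z \<le> 2 * (W + 2) / m"
      using m by (simp add: field_simps)
    then show ?thesis by linarith
  next
    case False
    then show ?thesis using K[of z] K[of "2 * z"] z by linarith
  qed
  moreover have "max (2 * (W + 2) / m) (2 * K) \<ge> 0"
    using K[of Z] Z by (simp add: le_max_iff_disj)
  ultimately show ?thesis using that by blast
qed

text \<open>Downwards this is slow decrease itself. Upwards, \<open>t\<close> is reached from
  \<open>x\<close> by about \<open>log 2 (t / x)\<close> doublings, each of which raises
  \<open>f\<close> by at most \<open>D\<close>.\<close>

lemma oscillation_bound:
  assumes lim: "(abel_mean f \<longlongrightarrow> 0) at_top"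
  obtains D E where "\<And>x t. x > 0 \<Longrightarrow> t > 0 \<Longrightarrow> \<bar>f t - f x\<bar> \<le> D + E * \<bar>ln (t / x)\<bar>"
proof -
  obtain D where D: "D \<ge> 0" "\<And>z. z > 0 \<Longrightarrow> f (2 * z) - f z \<le> D"
    using doubling_bounded[OF lim] by blast
  have iter: "f (2 ^ n * x) \<le> f x + real n * D" if "x > 0" for n x
  proof (induction n)
    case (Suc n)
    then show ?case using D(2)[of "2 ^ n * x"] that by (simp add: algebra_simps)
  qed simp
  have ln2: "ln (2::real) > 0" by simp
  have main: "\<bar>f t - f x\<bar> \<le> (D + A * ln 2) + (D / ln 2 + A) * \<bar>ln (t / x)\<bar>" if "0 < x" "x \<le> t" for x t
  proof -
    define r where "r = log 2 (t / x)"
    define n where "n = nat \<lceil>r\<rceil>"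
    have tx: "t / x \<ge> 1" using that by simp
    have r: "r \<ge> 0" using that by (simp add: r_def)
    then have n: "r \<le> real n" "real n \<le> r + 1"
      unfolding n_def by linarith+
    have t: "t = 2 powr r * x"
      using that by (simp add: r_def)
    have p: "2 ^ n = (2::real) powr real n" by (simp add: powr_realpow)
    have "t \<le> 2 ^ n * x"
      unfolding t p using n that by simp
    \<comment> \<open>Rounding the number of doublings up overshoots \<open>t\<close> by a factor of
      at most \<open>2\<close>; coming back by slow decrease costs at most
      \<open>A * ln 2\<close>.\<close>
    then have "f t - A * ln (2 ^ n * x / t) \<le> f (2 ^ n * x)"
      using that by (intro slow) auto
    moreover have "2 ^ n * x / t = 2 powr (real n - r)"
      unfolding t p using that by (simp add: powr_diff)
    then have "ln (2 ^ n * x / t) = (real n - r) * ln 2"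
      by (simp add: ln_powr)
    then have "A * ln (2 ^ n * x / t) \<le> A * ln 2"
      using n A_nonneg by (intro mult_left_mono) auto
    moreover have "real n * D \<le> (r + 1) * D"
      using n D by (intro mult_right_mono) auto
    ultimately have up: "f t - f x \<le> (D + A * ln 2) + r * D"
      using iter[OF that(1), of n] by (simp add: algebra_simps)
    have rr: "r * D = D / ln 2 * ln (t / x)" by (simp add: r_def log_def)
    have "- (A * ln (t / x)) \<le> f t - f x"
      using slow[OF that] by simp
    moreover have "0 \<le> A * ln (t / x)" "0 \<le> D / ln 2 * ln (t / x)" "0 \<le> D + A * ln 2"
      using D A_nonneg tx by auto
    ultimately show ?thesis
      using up tx unfolding rr by (simp add: distrib_right)
  qed
  have "\<bar>f t - f x\<bar> \<le> (D + A * ln 2) + (D / ln 2 + A) * \<bar>ln (t / x)\<bar>" if "0 < x" "0 < t" for x t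
  proof (cases "x \<le> t")
    case True
    then show ?thesis using main that by blast
  next
    case False
    have "\<bar>ln (t / x)\<bar> = \<bar>ln (x / t)\<bar>" using that by (simp add: ln_div)
    then show ?thesis using main[of t x] that False by (simp add: abs_minus_commute)
  qed
  then show ?thesis by (rule that)
qed

text \<open>The difference between \<open>abel_mean f x\<close> and \<open>f x\<close> is the mean
  of \<open>f (x * u) - f x\<close>. The oscillation bound dominates this by
  \<open>D + E * \<bar>ln u\<bar>\<close>, whose mean is finite and independent of
  \<open>x\<close>.\<close>

lemma bounded_of_abel_mean:
  assumes lim: "(abel_mean f \<longlongrightarrow> 0) at_top"
  obtains K where "\<And>t. t > 0 \<Longrightarrow> \<bar>f t\<bar> \<le> K"
proof -
  obtain D E where DE: "\<And>x t. x > 0 \<Longrightarrow> t > 0 \<Longrightarrow> \<bar>f t - f x\<bar> \<le> D + E * \<bar>ln (t / x)\<bar>"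
    using oscillation_bound[OF lim] by blast
  define W where "W = (\<integral>u. \<bar>ln u\<bar> \<partial>exp_measure)"
  obtain X where X: "X > 0" "\<And>x. x \<ge> X \<Longrightarrow> \<bar>abel_mean f x\<bar> < 1"
    using tendsto_0_at_topE[OF lim zero_less_one] by blast
  obtain C where C: "\<And>t. 0 < t \<Longrightarrow> t \<le> X \<Longrightarrow> \<bar>f t\<bar> \<le> C"
    using subexponential_bounded_initial[OF subexp] by blast
  have "\<bar>f x\<bar> \<le> max (1 + (D + E * W)) C" if x: "x > 0" for x
  proof (cases "x \<ge> X")
    case True
    have "\<bar>abel_mean f x - f x\<bar> = \<bar>\<integral>u. f (x * u) - f x \<partial>exp_measure\<bar>"
      using integrable_dilate[OF x]
      by (simp add: abel_mean_def measure_exp_measure_UNIV)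
    also have "\<dots> \<le> (\<integral>u. \<bar>f (x * u) - f x\<bar> \<partial>exp_measure)"
      by (rule integral_abs_bound)
    also have "\<dots> \<le> (\<integral>u. D + E * \<bar>ln u\<bar> \<partial>exp_measure)"
    proof (rule integral_mono_AE)
      show "AE u in exp_measure. \<bar>f (x * u) - f x\<bar> \<le> D + E * \<bar>ln u\<bar>"
        using AE_exp_measure_pos 
      proof eventually_elim
        case (elim u)
        then show ?case using DE[OF x, of "x * u"] x by simp
      qed
    qed (use integrable_exp_measure_abs_ln integrable_dilate[OF x] in auto)
    also have "\<dots> = D + E * W"
      using integrable_exp_measure_abs_ln
      by (simp add: W_def measure_exp_measure_UNIV)
    finally show ?thesis using X(2)[OF True] by linarith
  next
    case False
    then show ?thesis using C[of x] x by linarith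
  qed
  then show ?thesis by (rule that)
qed

text \<open>Weierstrass approximation: \<open>exp (- u)\<close> stays in \<open>[0, 1]\<close> and
  \<open>f\<close> is bounded, so a uniform error \<open>d\<close> in the kernel changes the
  integral by at most \<open>K * d\<close>. For a polynomial kernel the integral is a finite
  combination of Abel means at \<open>x / (i + 1)\<close>.\<close>

lemma continuous_kernel_tendsto_0:
  assumes lim: "(abel_mean f \<longlongrightarrow> 0) at_top"
    and g: "continuous_on UNIV g"
  shows "((\<lambda>x. \<integral>u. f (x * u) * g (exp (- u)) \<partial>exp_measure) \<longlongrightarrow> 0) at_top"
proof (rule tendstoI)
  fix e :: real assume e: "e > 0"
  have [measurable]: "g \<in> borel_measurable borel"
    using g by (rule borel_measurable_continuous_onI)
  obtain K where K: "\<And>t. t > 0 \<Longrightarrow> \<bar>f t\<bar> \<le> K"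
    using bounded_of_abel_mean[OF lim] by blast
  have K0: "K \<ge> 0" using K[of 1] by linarith
  \<comment> \<open>The \<open>+ 1\<close> keeps the denominator positive when
    \<open>K = 0\<close>.\<close>
  define d where "d = e / (2 * (K + 1))"
  have d: "d > 0" "K * d < e / 2"
    using e K0 by (auto simp: d_def field_simps)
  obtain p where p: "real_polynomial_function p" "\<And>v. v \<in> {0..1} \<Longrightarrow> \<bar>g v - p v\<bar> < d"
    using Stone_Weierstrass_real_polynomial_function[of "{0..1}" g d] d continuous_on_subset[OF g]
    by (metis compact_Icc subset_UNIV)
  obtain a n where pa: "p = (\<lambda>v. \<Sum>i\<le>n. a i * v ^ i)"
    using p(1) real_polynomial_function_iff_sum by blast
  have pint: "integrable exp_measure (\<lambda>u. f (x * u) * p (exp (- u)))"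
    and pval: "(\<integral>u. f (x * u) * p (exp (- u)) \<partial>exp_measure)
        = (\<Sum>i\<le>n. a i * (abel_mean f (x / real (Suc i)) / real (Suc i)))" if "x > 0" for x
  proof -
    have eq: "f (x * u) * p (exp (- u)) = (\<Sum>i\<le>n. a i * (f (x * u) * exp (- u) ^ i))" for u
      by (simp add: pa sum_distrib_left mult_ac)
    show "integrable exp_measure (\<lambda>u. f (x * u) * p (exp (- u)))"
      unfolding eq
      by (intro Bochner_Integration.integrable_sum integrable_mult_right integrable_power_kernel that)
    show "(\<integral>u. f (x * u) * p (exp (- u)) \<partial>exp_measure)
        = (\<Sum>i\<le>n. a i * (abel_mean f (x / real (Suc i)) / real (Suc i)))"
      unfolding eq
      by (subst Bochner_Integration.integral_sum)
         (use that integrable_power_kernel in \<open>auto simp: integral_power_kernel simp del: of_nat_Suc\<close>)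
  qed
  have "((\<lambda>x. \<Sum>i\<le>n. a i * (abel_mean f (x / real (Suc i)) / real (Suc i))) \<longlongrightarrow> 0) at_top"
  proof (rule tendsto_null_sum)
    fix i
    have "filterlim (\<lambda>x. x / real (Suc i)) at_top at_top"
      by real_asymp
    then have "((\<lambda>x. abel_mean f (x / real (Suc i))) \<longlongrightarrow> 0) at_top"
      by (rule filterlim_compose[OF lim])
    from tendsto_mult[OF tendsto_const tendsto_divide[OF this tendsto_const], of "real (Suc i)" "a i"]
    show "((\<lambda>x. a i * (abel_mean f (x / real (Suc i)) / real (Suc i))) \<longlongrightarrow> 0) at_top"
      by simp
  qed
  from tendstoD[OF this, of "e / 2"] e
  have "\<forall>\<^sub>F x in at_top. \<bar>\<Sum>i\<le>n. a i * (abel_mean f (x / real (Suc i)) / real (Suc i))\<bar> < e / 2"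
    by simp
  then show "\<forall>\<^sub>F x in at_top. dist (\<integral>u. f (x * u) * g (exp (- u)) \<partial>exp_measure) 0 < e"
    using eventually_gt_at_top[of 0]
  proof eventually_elim
    case (elim x)
    note x = elim(2)
    have bnd: "AE u in exp_measure. \<bar>f (x * u) * (g (exp (- u)) - p (exp (- u)))\<bar> \<le> K * d"
      using AE_exp_measure_pos
    proof eventually_elim
      case (elim u)
      then show ?case
        unfolding abs_mult using K[of "x * u"] p(2)[of "exp (- u)"] x K0 by (intro mult_mono) auto
    qed
    have [measurable]: "p \<in> borel_measurable borel"
      unfolding pa by measurable
    have dint: "integrable exp_measure (\<lambda>u. f (x * u) * (g (exp (- u)) - p (exp (- u))))"
      by (rule exp_measure.integrable_const_bound[where B = "K * d"]) (use bnd in auto)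
    have "f (x * u) * g (exp (- u))
        = f (x * u) * (g (exp (- u)) - p (exp (- u))) + f (x * u) * p (exp (- u))" for u
      by (simp add: algebra_simps)
    then have "(\<integral>u. f (x * u) * g (exp (- u)) \<partial>exp_measure)
        = (\<integral>u. f (x * u) * (g (exp (- u)) - p (exp (- u))) \<partial>exp_measure)
          + (\<integral>u. f (x * u) * p (exp (- u)) \<partial>exp_measure)"
      using Bochner_Integration.integral_add[OF dint pint[OF x]] by simp
    moreover have "\<bar>\<integral>u. f (x * u) * (g (exp (- u)) - p (exp (- u))) \<partial>exp_measure\<bar> \<le> K * d"
    proof -
      have "\<bar>\<integral>u. f (x * u) * (g (exp (- u)) - p (exp (- u))) \<partial>exp_measure\<bar>
          \<le> (\<integral>u. \<bar>f (x * u) * (g (exp (- u)) - p (exp (- u)))\<bar> \<partial>exp_measure)"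
        by (rule integral_abs_bound)
      also have "\<dots> \<le> (\<integral>u. K * d \<partial>exp_measure)"
        using dint bnd by (intro integral_mono_AE) auto
      finally show ?thesis
        by (simp add: measure_exp_measure_UNIV)
    qed
    ultimately show ?case
      using elim(1) d pval[OF x] by (simp add: dist_real_def)
  qed
qed

text \<open>For \<open>u\<close> in \<open>[1, \<beta>]\<close>, slow decrease traps
  \<open>f (x * u)\<close> between \<open>f x - A * d\<close> and
  \<open>f (\<beta> * x) + A * d\<close>. Averaging over a bump carried by this interval, whose mean
  against \<open>f\<close> tends to zero, gives an upper bound for \<open>f x\<close> and a lower
  bound for \<open>f (\<beta> * x)\<close>.\<close>

theorem tendsto_0_of_abel_mean:
  assumes lim: "(abel_mean f \<longlongrightarrow> 0) at_top"
  shows "(f \<longlongrightarrow> 0) at_top"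
proof (rule tendstoI)
  fix e :: real assume e: "e > 0"
  define d where "d = e / (2 * (A + 1))"
  have d: "d > 0" "A * d < e / 2"
    using e A_nonneg by (auto simp: d_def field_simps)
  \<comment> \<open>The width is chosen so that the slack \<open>A * ln \<beta> = A * d\<close>
    stays below \<open>e / 2\<close>.\<close>
  define \<beta> where "\<beta> = exp d"
  have \<beta>: "\<beta> > 1" "ln \<beta> = d" using d by (auto simp: \<beta>_def)
  \<comment> \<open>As a function of \<open>v\<close> this is the positive part of a quadratic with
    zeros \<open>exp (- \<beta>)\<close> and \<open>exp (- 1)\<close>; for
    \<open>v = exp (- u)\<close> it is positive exactly when \<open>1 < u < \<beta>\<close>.\<close>
  define g where "g v = max 0 ((v - exp (- \<beta>)) * (exp (- 1) - v))" for v :: real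
  define m where "m = (\<integral>u. g (exp (- u)) \<partial>exp_measure)"
  have gc: "continuous_on UNIV g" unfolding g_def by (intro continuous_intros)
  then have [measurable]: "g \<in> borel_measurable borel"
    by (rule borel_measurable_continuous_onI)
  have g0: "g v \<ge> 0" for v by (simp add: g_def)
  have gsupp: "g (exp (- u)) = 0" if "u \<notin> {1..\<beta>}" for u
  proof -
    have "(exp (- u) - exp (- \<beta>)) * (exp (- 1) - exp (- u)) \<le> 0"
      using that \<beta> by (cases "u < 1") (auto simp: mult_le_0_iff)
    then show ?thesis by (simp add: g_def)
  qed
  have gb: "\<bar>g (exp (- u))\<bar> \<le> 1" for u
  proof (cases "u \<in> {1..\<beta>}")
    case True
    have "(exp (- u) - exp (- \<beta>)) * (exp (- 1) - exp (- u)) \<le> 1 * 1"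
    proof (rule mult_mono)
      have "exp (- u) \<le> 1" "exp (- 1 :: real) \<le> 1" "0 < exp (- u)" "0 < exp (- \<beta>)" using True by auto
      then show "exp (- u) - exp (- \<beta>) \<le> 1" "exp (- 1) - exp (- u) \<le> 1" by linarith+
    qed (use True in auto)
    then show ?thesis by (simp add: g_def)
  qed (simp add: gsupp)
  have gint: "integrable exp_measure (\<lambda>u. g (exp (- u)))"
    by (rule exp_measure.integrable_const_bound[where B = 1]) (use gb in auto)
  have m: "m > 0"
  proof -
    \<comment> \<open>On the middle third of \<open>[1, \<beta>]\<close> each factor of the bump is
      bounded below by its value at one endpoint; \<open>\<eta>\<close> is the product of these two
      values.\<close>
    define p q where "p = 1 + (\<beta> - 1) / 3" and "q = 1 + 2 * (\<beta> - 1) / 3"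
    have pq: "1 < p" "p < q" "q < \<beta>" using \<beta> by (auto simp: p_def q_def field_simps)
    define \<eta> where "\<eta> = (exp (- q) - exp (- \<beta>)) * (exp (- 1) - exp (- p))"
    have \<eta>: "\<eta> > 0" unfolding \<eta>_def using pq by (intro mult_pos_pos) auto
    have "\<eta> * measure exp_measure {p..q} = (\<integral>u. \<eta> * indicator {p..q} u \<partial>exp_measure)"
      by simp
    also have "\<dots> \<le> m"
      unfolding m_def
    proof (rule integral_mono)
      fix u
      show "\<eta> * indicator {p..q} u \<le> g (exp (- u))"
      proof (cases "u \<in> {p..q}")
        case True
        then have "\<eta> \<le> (exp (- u) - exp (- \<beta>)) * (exp (- 1) - exp (- u))"
          unfolding \<eta>_def using pq by (intro mult_mono) auto
        then show ?thesis using True by (simp add: g_def)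
      qed (use g0 in simp)
    qed (use gint integrable_exp_measure_Icc in auto)
    finally show ?thesis
      using \<eta> measure_exp_measure_Icc_pos[of p q] pq
      by (metis less_le_trans less_trans mult_pos_pos zero_less_one)
  qed
  define J where "J x = (\<integral>u. f (x * u) * g (exp (- u)) \<partial>exp_measure)" for x
  have fgint: "integrable exp_measure (\<lambda>u. f (x * u) * g (exp (- u)))" if "x > 0" for x
  proof (rule Bochner_Integration.integrable_bound[OF integrable_dilate[OF that]])
    show "AE u in exp_measure. norm (f (x * u) * g (exp (- u))) \<le> norm (f (x * u))"
      using gb by (auto simp: abs_mult intro!: mult_left_le)
  qed auto
  have J: "m * (f x - A * d) \<le> J x" "J x \<le> m * (f (\<beta> * x) + A * d)" if x: "x > 0" for x
  proof -
    have low: "(f x - A * d) * g (exp (- u)) \<le> f (x * u) * g (exp (- u))" 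
      and up: "f (x * u) * g (exp (- u)) \<le> (f (\<beta> * x) + A * d) * g (exp (- u))" for u
    proof -
      consider "u \<in> {1..\<beta>}" | "g (exp (- u)) = 0" using gsupp by blast
      then have "(f x - A * d) * g (exp (- u)) \<le> f (x * u) * g (exp (- u)) \<and>
        f (x * u) * g (exp (- u)) \<le> (f (\<beta> * x) + A * d) * g (exp (- u))"
      proof cases
        case 1
        then have u: "1 \<le> u" "u \<le> \<beta>" by auto
        have "f x - A * ln (x * u / x) \<le> f (x * u)"
          using x u by (intro slow) auto
        moreover have "A * ln (x * u / x) \<le> A * d"
          using x u A_nonneg \<beta> by (intro mult_left_mono) (auto simp flip: \<beta>(2))
        moreover have "f (x * u) - A * ln (\<beta> * x / (x * u)) \<le> f (\<beta> * x)"
          using x u by (intro slow) auto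
        moreover have "A * ln (\<beta> * x / (x * u)) \<le> A * d"
          using x u A_nonneg \<beta> unfolding \<beta>(2)[symmetric]
          by (intro mult_left_mono, subst ln_le_cancel_iff) (auto simp: field_simps)
        ultimately show ?thesis
          using g0[of "exp (- u)"] by (intro conjI mult_right_mono) auto
      qed simp
      then show "(f x - A * d) * g (exp (- u)) \<le> f (x * u) * g (exp (- u))"
        and "f (x * u) * g (exp (- u)) \<le> (f (\<beta> * x) + A * d) * g (exp (- u))"
        by auto
    qed
    have "(\<integral>u. (f x - A * d) * g (exp (- u)) \<partial>exp_measure) \<le> J x"
      unfolding J_def using gint fgint[OF x] low by (intro integral_mono) auto
    then show "m * (f x - A * d) \<le> J x"
      by (simp add: m_def mult.commute)
    have "J x \<le> (\<integral>u. (f (\<beta> * x) + A * d) * g (exp (- u)) \<partial>exp_measure)"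
      unfolding J_def using gint fgint[OF x] up by (intro integral_mono) auto
    then show "J x \<le> m * (f (\<beta> * x) + A * d)"
      by (simp add: m_def mult.commute)
  qed
  have "(J \<longlongrightarrow> 0) at_top"
    unfolding J_def using continuous_kernel_tendsto_0[OF lim gc] .
  then obtain X where X: "\<And>x. x \<ge> X \<Longrightarrow> \<bar>J x\<bar> < m * (e / 2)"
    using tendsto_0_at_topE[of J "m * (e / 2)"] m e by auto
  show "\<forall>\<^sub>F x in at_top. dist (f x) 0 < e"
    \<comment> \<open>The upper bound for \<open>f x\<close> uses \<open>J x\<close>, the lower
      bound uses \<open>J (x / \<beta>)\<close>; this threshold puts both arguments beyond
      \<open>X\<close> and makes them positive.\<close>
    using eventually_ge_at_top[of "\<beta> * max X 1"]
  proof eventually_elim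
    case (elim x)
    have "1 * max X 1 \<le> \<beta> * max X 1" using \<beta> by (intro mult_right_mono) auto
    with elim have x: "x \<ge> X" "x > 0" by linarith+
    have x': "x / \<beta> \<ge> max X 1" using elim \<beta>
      by (metis less_trans mult.commute pos_le_divide_eq zero_less_one)
    then have x'': "x / \<beta> \<ge> X" "x / \<beta> > 0" by linarith+
    have "m * (f x - A * d) < m * (e / 2)"
      using J(1)[OF x(2)] X[OF x(1)] by linarith
    then have "f x - A * d < e / 2" using m by simp
    moreover have "m * (- (e / 2)) < m * (f x + A * d)"
      using J(2)[OF x''(2)] X[OF x''(1)] \<beta> by simp
    then have "- (e / 2) < f x + A * d" using m by (simp only: mult_less_cancel_left_pos)
    ultimately show ?case using d by (simp add: dist_real_def)
  qed
qed

end

section \<open>Riemann--Stieltjes integrals and Cesaro limits\<close>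

lemma is_partition_mono:
  assumes "is_partition a b n p" "i \<le> j" "j \<le> n"
  shows "p i \<le> p j"
  using assms(2,3)
proof (induction j rule: dec_induct)
  case (step j)
  then have "p j < p (Suc j)" using assms(1) by (auto simp: is_partition_def)
  then show ?case using step by simp
qed simp

lemma is_partition_extend:
  assumes "is_partition a x n p" "x < y"
  shows "is_partition a y (Suc n) (p(Suc n := y))"
  using assms by (auto simp: is_partition_def less_Suc_eq)

lemma is_partition_fine_exists:
  assumes "a \<le> b" "\<delta> > 0"
  obtains n p where "is_partition a b n p" "\<And>i. i < n \<Longrightarrow> p (Suc i) - p i < \<delta>"
proof (cases "a = b")
  case True
  \<comment> \<open>Partitions are strictly increasing, so a degenerate interval admits only the
    partition with no cells.\<close>
  have "is_partition a b 0 (\<lambda>_. a)" using True by (simp add: is_partition_def)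
  then show ?thesis using that by blast
next
  case False
  then have ab: "a < b" using assms by simp
  obtain n where n: "(b - a) / \<delta> < real n" using reals_Archimedean2 by blast
  have "(b - a) / \<delta> > 0" using ab assms by simp
  then have n0: "real n > 0" using n by linarith
  define p where "p i = a + real i * ((b - a) / real n)" for i
  have step: "p (Suc i) - p i = (b - a) / real n" for i
    by (simp add: p_def distrib_right add_divide_distrib)
  have "(b - a) / real n > 0" using ab n0 by simp
  then have "is_partition a b n p"
    unfolding is_partition_def using n0 step by (metis add.right_neutral add_diff_cancel_left'
        diff_gt_0_iff_gt mult_zero_left nonzero_mult_div_cancel_left of_nat_0 order_less_irrefl p_def
        times_divide_eq_right diff_add_cancel add.commute)
  moreover have "(b - a) / real n < \<delta>"
    using n n0 assms by (simp add: field_simps)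
  ultimately show ?thesis using that step by metis
qed

text \<open>\<open>V x\<close> is the total variation of \<open>s\<close> over
  \<open>[-1, max x (-1)]\<close>. The base point \<open>-1\<close> serves the whole line because
  \<open>s\<close> vanishes on the negative axis, so that
  \<open>s x = s (max x (-1))\<close>.\<close>

lemma locally_bounded_variation_majorant:
  assumes bv: "locally_bounded_variation s" and neg: "\<And>x. x < 0 \<Longrightarrow> s x = 0"
  obtains V :: "real \<Rightarrow> real" where "\<And>x y. x \<le> y \<Longrightarrow> \<bar>s y - s x\<bar> \<le> V y - V x"
proof -
  define S where "S x = {(\<Sum>i<n. \<bar>s (p (Suc i)) - s (p i)\<bar>) |n p. is_partition (-1) x n p}" for x
  have bdd: "bdd_above (S x)" if "x \<ge> -1" for x
    using bv that unfolding locally_bounded_variation_def bounded_variation_on_def S_def bdd_above_def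
    by blast
  have step: "\<bar>s y - s x\<bar> \<le> Sup (S y) - Sup (S x)" if "-1 \<le> x" "x < y" for x y
  proof -
    obtain n0 p0 where "is_partition (-1) x n0 p0"
      using is_partition_fine_exists[of "-1" x 1] \<open>-1 \<le> x\<close> by (metis zero_less_one)
    then have ne: "S x \<noteq> {}" by (auto simp: S_def)
    have "v \<le> Sup (S y) - \<bar>s y - s x\<bar>" if v: "v \<in> S x" for v
    proof -
      obtain n p where v': "v = (\<Sum>i<n. \<bar>s (p (Suc i)) - s (p i)\<bar>)" and p: "is_partition (-1) x n p"
        using v by (auto simp: S_def)
      \<comment> \<open>Appending the node \<open>y\<close> adds exactly one cell, and with it the
        term \<open>\<bar>s y - s x\<bar>\<close>, to the variation sum.\<close>
      define q where "q = p(Suc n := y)"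
      have "(\<Sum>i<Suc n. \<bar>s (q (Suc i)) - s (q i)\<bar>) \<in> S y"
        using is_partition_extend[OF p \<open>x < y\<close>] unfolding S_def q_def by blast
      moreover have "(\<Sum>i<Suc n. \<bar>s (q (Suc i)) - s (q i)\<bar>) = v + \<bar>s y - s x\<bar>"
        using p by (simp add: v' q_def is_partition_def)
      ultimately have "v + \<bar>s y - s x\<bar> \<in> S y" by simp
      then show ?thesis
        using bdd[of y] \<open>-1 \<le> x\<close> \<open>x < y\<close> cSup_upper by fastforce
    qed
    then have "Sup (S x) \<le> Sup (S y) - \<bar>s y - s x\<bar>"
      using ne by (intro cSup_least) auto
    then show ?thesis by simp
  qed
  have "\<bar>s y - s x\<bar> \<le> Sup (S (max y (-1))) - Sup (S (max x (-1)))" if "x \<le> y" for x y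
  proof -
    have "s x = s (max x (-1))" "s y = s (max y (-1))"
      by (auto simp: max_def neg)
    moreover have "max x (-1) = max y (-1) \<or> max x (-1) < max y (-1)"
      using that by linarith
    ultimately show ?thesis using step[of "max x (-1)" "max y (-1)"] by auto
  qed
  then show ?thesis by (rule that)
qed

text \<open>The by-parts expression \<open>R p q\<close> is additive over adjacent cells and differs
  from the Riemann-Stieltjes term of a cell by at most \<open>2 * K * (q - p) * (V q - V p)\<close>.
  On a partition of mesh below \<open>\<delta>\<close> these errors telescope to at most
  \<open>2 * K * \<delta> * (V b - V a)\<close>.\<close>

lemma has_RS_integral_by_parts:
  fixes \<phi> s V :: "real \<Rightarrow> real"
  assumes ab: "a \<le> b"
    and V: "\<And>x y. a \<le> x \<Longrightarrow> x \<le> y \<Longrightarrow> y \<le> b \<Longrightarrow> \<bar>s y - s x\<bar> \<le> V y - V x"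
    and der: "\<And>t. t \<in> {a..b} \<Longrightarrow> (\<phi> has_real_derivative \<phi>' t) (at t within {a..b})"
    and bd: "\<And>t. t \<in> {a..b} \<Longrightarrow> \<bar>\<phi>' t\<bar> \<le> K"
    and int: "(\<lambda>t. s t * \<phi>' t) integrable_on {a..b}"
  shows "has_RS_integral \<phi> s a b (\<phi> b * s b - \<phi> a * s a - integral {a..b} (\<lambda>t. s t * \<phi>' t))"
  unfolding has_RS_integral_def
proof (intro allI impI)
  fix \<epsilon> :: real assume \<epsilon>: "\<epsilon> > 0"
  have K0: "K \<ge> 0" using bd[of a] ab by auto
  have V0: "V b - V a \<ge> 0" using V[of a b] ab by auto
  define c where "c = 2 * K * (V b - V a)"
  have c0: "c \<ge> 0" using K0 V0 by (simp add: c_def)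
  define \<delta> where "\<delta> = \<epsilon> / (c + 1)"
  have \<delta>: "\<delta> > 0" "\<delta> * c < \<epsilon>" using \<epsilon> c0 by (auto simp: \<delta>_def field_simps)
  define R where "R p q = \<phi> q * s q - \<phi> p * s p - integral {p..q} (\<lambda>t. s t * \<phi>' t)" for p q
  have local: "\<bar>\<phi> \<xi> * (s q - s p) - R p q\<bar> \<le> 2 * K * (q - p) * (V q - V p)"
    if "a \<le> p" "p \<le> \<xi>" "\<xi> \<le> q" "q \<le> b" for p q \<xi>
  proof -
    have sub: "{p..q} \<subseteq> {a..b}" using that by auto
    have Vpq: "V q - V p \<ge> 0" using V[of p q] that by linarith
    have i1: "(\<phi>' has_integral (\<phi> q - \<phi> p)) {p..q}"
      using that by (intro fundamental_theorem_of_calculus)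
        (auto simp flip: has_real_derivative_iff_has_vector_derivative
              intro!: has_field_derivative_subset[OF der])
    have i2: "((\<lambda>t. s t * \<phi>' t) has_integral integral {p..q} (\<lambda>t. s t * \<phi>' t)) {p..q}"
      using integrable_subinterval_real[OF int sub] by (simp add: has_integral_integral)
    have "((\<lambda>t. s q * \<phi>' t - s t * \<phi>' t) has_integral
        (s q * (\<phi> q - \<phi> p) - integral {p..q} (\<lambda>t. s t * \<phi>' t))) {p..q}"
      by (intro has_integral_diff has_integral_mult_right i1 i2)
    moreover have "norm (s q * \<phi>' t - s t * \<phi>' t) \<le> K * (V q - V p)" if t: "t \<in> {p..q}" for t
    proof -
      have "\<bar>s q - s t\<bar> \<le> V q - V p"
        using V[of t q] V[of p t] t \<open>a \<le> p\<close> \<open>q \<le> b\<close> by auto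
      then have "\<bar>\<phi>' t\<bar> * \<bar>s q - s t\<bar> \<le> K * (V q - V p)"
        using bd[of t] t sub K0 by (intro mult_mono) auto
      moreover have "s q * \<phi>' t - s t * \<phi>' t = \<phi>' t * (s q - s t)"
        by (simp add: algebra_simps)
      ultimately show ?thesis by (simp only: real_norm_def abs_mult)
    qed
    ultimately have "norm (s q * (\<phi> q - \<phi> p) - integral {p..q} (\<lambda>t. s t * \<phi>' t))
        \<le> K * (V q - V p) * measure lborel {p..q}"
      using K0 Vpq by (intro has_integral_bound_real[where f = "\<lambda>t. s q * \<phi>' t - s t * \<phi>' t" and S = "{}"]) auto
    then have *: "\<bar>s q * (\<phi> q - \<phi> p) - integral {p..q} (\<lambda>t. s t * \<phi>' t)\<bar>
        \<le> K * (q - p) * (V q - V p)"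
      using that by (simp add: mult_ac)
    have "norm (\<phi> \<xi> - \<phi> p) \<le> K * norm (\<xi> - p)"
      using that bd
      by (intro field_differentiable_bound[of "{a..b}" \<phi> \<phi>']) (auto intro!: der)
    also have "\<dots> \<le> K * (q - p)"
      using that K0 by (intro mult_left_mono) auto
    finally have "\<bar>\<phi> \<xi> - \<phi> p\<bar> * \<bar>s q - s p\<bar> \<le> K * (q - p) * (V q - V p)"
      using V[of p q] that K0 by (intro mult_mono) auto
    then have "\<bar>(\<phi> \<xi> - \<phi> p) * (s q - s p)\<bar> \<le> K * (q - p) * (V q - V p)"
      by (simp add: abs_mult)
    \<comment> \<open>The two error sources, each worth one \<open>K\<close>: moving the tag from
      \<open>\<xi>\<close> to \<open>p\<close>, and replacing \<open>s t\<close> by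
      \<open>s q\<close> under the integral.\<close>
    moreover have "\<phi> \<xi> * (s q - s p) - R p q = (\<phi> \<xi> - \<phi> p) * (s q - s p)
        - (s q * (\<phi> q - \<phi> p) - integral {p..q} (\<lambda>t. s t * \<phi>' t))"
      by (simp add: R_def algebra_simps)
    ultimately show ?thesis using * by linarith
  qed
  show "\<exists>\<delta>>0. \<forall>n p \<xi>. is_partition a b n p \<and> (\<forall>i<n. p i \<le> \<xi> i \<and> \<xi> i \<le> p (Suc i)) \<and>
        (\<forall>i<n. p (Suc i) - p i < \<delta>) \<longrightarrow>
        \<bar>(\<Sum>i<n. \<phi> (\<xi> i) * (s (p (Suc i)) - s (p i))) -
          (\<phi> b * s b - \<phi> a * s a - integral {a..b} (\<lambda>t. s t * \<phi>' t))\<bar> < \<epsilon>"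
  proof (intro exI[of _ \<delta>] conjI allI impI \<delta>(1), elim conjE)
    fix n p \<xi>
    assume p: "is_partition a b n p" and \<xi>: "\<forall>i<n. p i \<le> \<xi> i \<and> \<xi> i \<le> p (Suc i)"
      and mesh: "\<forall>i<n. p (Suc i) - p i < \<delta>"
    have pab: "p 0 = a" "p n = b" using p by (auto simp: is_partition_def)
    have pi: "a \<le> p i" "p i \<le> b" if "i \<le> n" for i
      using is_partition_mono[OF p, of 0 i] is_partition_mono[OF p, of i n] that pab by auto
    have tele: "(\<Sum>i<m. R (p i) (p (Suc i))) = R a (p m)" if "m \<le> n" for m
      using that
    proof (induction m)
      case 0
      then show ?case using pab by (simp add: R_def)
    next
      case (Suc m)
      have "integral {a..p m} (\<lambda>t. s t * \<phi>' t) + integral {p m..p (Suc m)} (\<lambda>t. s t * \<phi>' t)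
          = integral {a..p (Suc m)} (\<lambda>t. s t * \<phi>' t)"
        using Suc.prems pi[of m] pi[of "Suc m"] is_partition_mono[OF p, of m "Suc m"]
        by (intro Henstock_Kurzweil_Integration.integral_combine integrable_subinterval_real[OF int]) auto
      then show ?case using Suc by (simp add: R_def)
    qed
    have "\<bar>(\<Sum>i<n. \<phi> (\<xi> i) * (s (p (Suc i)) - s (p i))) - R a b\<bar>
        = \<bar>\<Sum>i<n. \<phi> (\<xi> i) * (s (p (Suc i)) - s (p i)) - R (p i) (p (Suc i))\<bar>"
      using tele[of n] pab by (simp add: sum_subtractf)
    also have "\<dots> \<le> (\<Sum>i<n. \<bar>\<phi> (\<xi> i) * (s (p (Suc i)) - s (p i)) - R (p i) (p (Suc i))\<bar>)"
      by (rule sum_abs)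
    also have "\<dots> \<le> (\<Sum>i<n. 2 * K * \<delta> * (V (p (Suc i)) - V (p i)))"
    proof (rule sum_mono)
      fix i assume "i \<in> {..<n}"
      then have i: "i < n" by simp
      have "\<bar>\<phi> (\<xi> i) * (s (p (Suc i)) - s (p i)) - R (p i) (p (Suc i))\<bar>
          \<le> 2 * K * (p (Suc i) - p i) * (V (p (Suc i)) - V (p i))"
        using i \<xi> pi[of i] pi[of "Suc i"] by (intro local) auto
      also have "\<dots> \<le> 2 * K * \<delta> * (V (p (Suc i)) - V (p i))"
        using i mesh K0 V[of "p i" "p (Suc i)"] pi[of i] pi[of "Suc i"] is_partition_mono[OF p, of i "Suc i"]
        by (intro mult_right_mono mult_left_mono) (auto intro: less_imp_le)
      finally show "\<bar>\<phi> (\<xi> i) * (s (p (Suc i)) - s (p i)) - R (p i) (p (Suc i))\<bar>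
          \<le> 2 * K * \<delta> * (V (p (Suc i)) - V (p i))" .
    qed
    also have "\<dots> = 2 * K * \<delta> * (V b - V a)"
      using sum_lessThan_telescope[of "\<lambda>i. V (p i)" n] pab by (simp flip: sum_distrib_left)
    also have "\<dots> = \<delta> * c" by (simp add: c_def)
    also have "\<dots> < \<epsilon>" by (rule \<delta>(2))
    finally show "\<bar>(\<Sum>i<n. \<phi> (\<xi> i) * (s (p (Suc i)) - s (p i))) -
          (\<phi> b * s b - \<phi> a * s a - integral {a..b} (\<lambda>t. s t * \<phi>' t))\<bar> < \<epsilon>"
      by (simp add: R_def)
  qed
qed

lemma has_RS_integral_unique:
  assumes ab: "a \<le> b" and I: "has_RS_integral \<phi> s a b I" and J: "has_RS_integral \<phi> s a b J"
  shows "I = J"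
proof (rule ccontr)
  assume "I \<noteq> J"
  define \<epsilon> where "\<epsilon> = \<bar>I - J\<bar> / 2"
  have \<epsilon>: "\<epsilon> > 0" using \<open>I \<noteq> J\<close> by (simp add: \<epsilon>_def)
  obtain d1 where d1: "d1 > 0" "\<And>n p \<xi>. is_partition a b n p \<Longrightarrow>
      (\<forall>i<n. p i \<le> \<xi> i \<and> \<xi> i \<le> p (Suc i)) \<Longrightarrow> (\<forall>i<n. p (Suc i) - p i < d1) \<Longrightarrow>
        \<bar>(\<Sum>i<n. \<phi> (\<xi> i) * (s (p (Suc i)) - s (p i))) - I\<bar> < \<epsilon>"
    using I \<epsilon> unfolding has_RS_integral_def by meson
  obtain d2 where d2: "d2 > 0" "\<And>n p \<xi>. is_partition a b n p \<Longrightarrow>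
      (\<forall>i<n. p i \<le> \<xi> i \<and> \<xi> i \<le> p (Suc i)) \<Longrightarrow> (\<forall>i<n. p (Suc i) - p i < d2) \<Longrightarrow>
        \<bar>(\<Sum>i<n. \<phi> (\<xi> i) * (s (p (Suc i)) - s (p i))) - J\<bar> < \<epsilon>"
    using J \<epsilon> unfolding has_RS_integral_def by meson
  obtain n p where p: "is_partition a b n p" "\<And>i. i < n \<Longrightarrow> p (Suc i) - p i < min d1 d2"
    using is_partition_fine_exists[OF ab, of "min d1 d2"] d1(1) d2(1) by auto
  have tags: "\<forall>i<n. p i \<le> p i \<and> p i \<le> p (Suc i)"
    using is_partition_mono[OF p(1)] by auto
  define S where "S = (\<Sum>i<n. \<phi> (p i) * (s (p (Suc i)) - s (p i)))"
  have "\<bar>S - I\<bar> < \<epsilon>" "\<bar>S - J\<bar> < \<epsilon>"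
    unfolding S_def using d1(2)[OF p(1) tags] d2(2)[OF p(1) tags] p(2) by auto
  then have "\<bar>I - J\<bar> < 2 * \<epsilon>" by linarith
  then show False by (simp add: \<epsilon>_def)
qed

lemma RS_integral_eq:
  assumes "a \<le> b" "has_RS_integral \<phi> s a b I"
  shows "RS_integral \<phi> s a b = I"
  unfolding RS_integral_def using assms has_RS_integral_unique by blast

text \<open>Iterated integration preserves inequalities. Only a fixed initial interval
  \<open>[0, X]\<close>, where \<open>G\<close> may lie below \<open>K\<close>, does damage, and it
  contributes \<open>O(x ^ (k - 1))\<close>, negligible against \<open>x ^ k\<close>. Combined with
  monotonicity, this is how a Cesaro limit bounds a function.\<close>

lemma cesaro_lim_lower_bound:
  assumes ces: "cesaro_lim G k l"
    and int: "\<And>x. x \<ge> 0 \<Longrightarrow> (\<lambda>t. (x - t) ^ (k - 1) * G t) integrable_on {0..x}"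
    and bdd: "\<And>x. x \<ge> 0 \<Longrightarrow> \<exists>M. \<forall>t\<in>{0..x}. \<bar>G t\<bar> \<le> M"
    and ev: "\<forall>\<^sub>F x in at_top. K \<le> G x"
  shows "K \<le> l"
proof (cases "k = 0")
  case True
  have "((\<lambda>x. G x - l) \<longlongrightarrow> 0) at_top"
    using smalloD_tendsto[OF ces[unfolded cesaro_lim_def]] True by (simp add: iter_integral_def)
  then have "(G \<longlongrightarrow> l) at_top" by (simp add: LIM_zero_iff)
  then show ?thesis using ev by (rule tendsto_lowerbound) simp
next
  case False
  then obtain j where k: "k = Suc j" by (cases k) auto
  obtain X where X: "X \<ge> 0" "\<And>x. x \<ge> X \<Longrightarrow> K \<le> G x"
    using ev unfolding eventually_at_top_linorder by (metis max.bounded_iff max.cobounded2)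
  obtain M0 where M0: "\<forall>t\<in>{0..X}. \<bar>G t\<bar> \<le> M0" using bdd[OF X(1)] by blast
  define M where "M = M0 + \<bar>K\<bar>"
  have M: "- M \<le> G t - K" if "t \<in> {0..X}" for t
    using M0[rule_format, OF that] by (simp add: M_def)
  have Mpos: "M \<ge> 0" using M0 X(1) by (force simp: M_def)
  \<comment> \<open>On \<open>[0, X]\<close> one has \<open>G t - K \<ge> - M\<close> and
    \<open>(x - t) ^ j \<le> x ^ j\<close>, which produces the error \<open>M * X * x ^ j\<close>;
    on \<open>[X, x]\<close> the integrand \<open>h\<close> of \<open>G - K\<close> is
    nonnegative.\<close>
  have low: "iter_integral G k x \<ge> K * x ^ k / fact k - M * X * x ^ j / fact j" if x: "x \<ge> max X 1" for x
  proof -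
    have x0: "x > 0" "X \<le> x" using x by auto
    have pw: "((\<lambda>t. (x - t) ^ j) has_integral (x ^ k / real k)) {0..x}"
    proof -
      have "((\<lambda>t. (x - t) ^ j) has_integral (- ((x - x) ^ k / real k) - (- ((x - 0) ^ k / real k)))) {0..x}"
        unfolding k using x0
        by (intro fundamental_theorem_of_calculus)
           (auto simp flip: has_real_derivative_iff_has_vector_derivative
                 intro!: derivative_eq_intros simp del: of_nat_Suc power_Suc)
      then show ?thesis using k by (simp del: of_nat_Suc)
    qed
    define h where "h t = (x - t) ^ j * G t - K * (x - t) ^ j" for t
    have hi: "h integrable_on {0..x}"
      unfolding h_def using int[of x] pw x0 k
      by (intro Henstock_Kurzweil_Integration.integrable_diff integrable_on_mult_right) auto
    have "integral {0..x} (\<lambda>t. (x - t) ^ j * G t) - K * (x ^ k / real k) = integral {0..x} h"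
      unfolding h_def using int[of x] pw x0 k
      by (subst Henstock_Kurzweil_Integration.integral_diff)
         (auto simp: integral_unique[OF pw] intro!: integrable_on_mult_right)
    moreover have "integral {0..x} h = integral {0..X} h + integral {X..x} h"
      using X x0 hi by (intro Henstock_Kurzweil_Integration.integral_combine[symmetric]) auto
    moreover have "integral {X..x} h \<ge> 0"
    proof (rule integral_nonneg)
      show "h integrable_on {X..x}"
        using X by (intro integrable_subinterval_real[OF hi]) auto
      fix t assume "t \<in> {X..x}"
      then have "0 \<le> (x - t) ^ j * (G t - K)"
        using X(2)[of t] by (intro mult_nonneg_nonneg) auto
      then show "0 \<le> h t" by (simp add: h_def algebra_simps)
    qed
    moreover have "integral {0..X} h \<ge> integral {0..X} (\<lambda>_. - M * x ^ j)"
    proof (rule integral_le)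
      show "h integrable_on {0..X}"
        using x0 by (intro integrable_subinterval_real[OF hi]) auto
      fix t assume t: "t \<in> {0..X}"
      have "- M * x ^ j \<le> - M * (x - t) ^ j"
        using t x0 Mpos by (intro mult_left_mono_neg power_mono) auto
      also have "\<dots> \<le> (G t - K) * (x - t) ^ j"
        using M[OF t] t x0 by (intro mult_right_mono) auto
      also have "\<dots> = h t" by (simp add: h_def algebra_simps)
      finally show "- M * x ^ j \<le> h t" .
    qed auto
    ultimately have "integral {0..x} (\<lambda>t. (x - t) ^ j * G t) \<ge> K * (x ^ k / real k) - M * X * x ^ j"
      using X(1) by (simp add: mult_ac)
    then have "iter_integral G k x \<ge> (K * (x ^ k / real k) - M * X * x ^ j) / fact j"
      unfolding iter_integral_def using k by (simp add: divide_right_mono)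
    moreover have "(K * (x ^ k / real k) - M * X * x ^ j) / fact j = K * x ^ k / fact k - M * X * x ^ j / fact j"
      using k by (simp add: diff_divide_distrib del: of_nat_Suc)
    ultimately show ?thesis by simp
  qed
  have "((\<lambda>x. (iter_integral G k x - l * x ^ k / fact k) / x ^ k) \<longlongrightarrow> 0) at_top"
    using ces unfolding cesaro_lim_def by (rule smalloD_tendsto)
  then have "((\<lambda>x. (iter_integral G k x - l * x ^ k / fact k) / x ^ k + M * X / fact j / x) \<longlongrightarrow> 0 + 0) at_top"
    by (rule tendsto_add) real_asymp
  moreover have "\<forall>\<^sub>F x in at_top. (K - l) / fact k \<le>
      (iter_integral G k x - l * x ^ k / fact k) / x ^ k + M * X / fact j / x"
    using eventually_ge_at_top[of "max X 1"]
  proof eventually_elim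
    case (elim x)
    then have x0: "x > 0" by auto
    have "(K * x ^ k / fact k - M * X * x ^ j / fact j - l * x ^ k / fact k) / x ^ k
        \<le> (iter_integral G k x - l * x ^ k / fact k) / x ^ k"
      using low[OF elim] x0 by (intro divide_right_mono) auto
    moreover have "(K * x ^ k / fact k - M * X * x ^ j / fact j - l * x ^ k / fact k) / x ^ k
        = (K - l) / fact k - M * X / fact j / x"
      using x0 k by (simp add: diff_divide_distrib del: fact_Suc)
    ultimately show ?case by linarith
  qed
  ultimately have "(K - l) / fact k \<le> 0 + 0"
    by (rule tendsto_lowerbound) simp
  then show ?thesis by (simp add: divide_le_0_iff not_le[THEN iffD2, OF fact_gt_zero])
qed

lemma cesaro_lim_uminus:
  "cesaro_lim G k l \<Longrightarrow> cesaro_lim (\<lambda>x. - G x) k (- l)"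
proof -
  assume "cesaro_lim G k l"
  then have "(\<lambda>x. - (iter_integral G k x - l * x ^ k / fact k)) \<in> o[at_top](\<lambda>x. x ^ k)"
    unfolding cesaro_lim_def by (subst landau_o.small.uminus_in_iff)
  moreover have "iter_integral (\<lambda>x. - G x) k x = - iter_integral G k x" for x
    by (simp add: iter_integral_def)
  ultimately show ?thesis
    unfolding cesaro_lim_def by (simp add: algebra_simps)
qed

text \<open>Regularity of Cesaro limits: the lower bound applies to \<open>G\<close> and to
  \<open>- G\<close>, with an arbitrarily small loss \<open>e\<close>.\<close>

lemma cesaro_lim_unique:
  assumes ces: "cesaro_lim G k l"
    and int: "\<And>x. x \<ge> 0 \<Longrightarrow> (\<lambda>t. (x - t) ^ (k - 1) * G t) integrable_on {0..x}"
    and bdd: "\<And>x. x \<ge> 0 \<Longrightarrow> \<exists>M. \<forall>t\<in>{0..x}. \<bar>G t\<bar> \<le> M"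
    and lim: "(G \<longlongrightarrow> g) at_top"
  shows "l = g"
proof (rule antisym)
  show "g \<le> l"
  proof (rule field_le_epsilon)
    fix e :: real assume "e > 0"
    then have "\<forall>\<^sub>F x in at_top. g - e \<le> G x"
      using order_tendstoD(1)[OF lim, of "g - e"] by (auto elim: eventually_mono)
    then show "g \<le> l + e"
      using cesaro_lim_lower_bound[OF ces int bdd] by fastforce
  qed
  show "l \<le> g"
  proof (rule field_le_epsilon)
    fix e :: real assume "e > 0"
    then have "\<forall>\<^sub>F x in at_top. - (g + e) \<le> - G x"
      using order_tendstoD(2)[OF lim, of "g + e"] by (auto elim: eventually_mono)
    moreover have "(\<lambda>t. (x - t) ^ (k - 1) * - G t) integrable_on {0..x}" if "x \<ge> 0" for x
      using integrable_neg[OF int[OF that]] by simp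
    ultimately have "- (g + e) \<le> - l"
      using cesaro_lim_lower_bound[OF cesaro_lim_uminus[OF ces]] bdd by simp
    then show "l \<le> g + e" by simp
  qed
qed

text \<open>Passes from Lebesgue integrals over the open half-line to gauge integrals over
  \<open>{0..x}\<close>; the two domains differ by the null set \<open>{0}\<close>.\<close>

lemma integral_tendsto_at_top:
  fixes h :: "real \<Rightarrow> real"
  assumes "set_integrable lborel {0<..} h"
  shows "((\<lambda>x. integral {0..x} h) \<longlongrightarrow> (LINT t:{0<..}|lborel. h t)) at_top"
    and "h integrable_on {0..x}"
proof -
  have eq: "(LINT t:{0<..x}|lborel. h t) = integral {0..x} h \<and> h integrable_on {0..x}" for x
  proof -
    have "set_integrable lborel {0<..x} h"
      by (rule set_integrable_subset[OF assms]) auto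
    then have *: "h integrable_on {0<..x}" "(LINT t:{0<..x}|lborel. h t) = integral {0<..x} h"
      using set_borel_integral_eq_integral by blast+
    have neg: "negligible ({0<..x} - {0..x} \<union> ({0..x} - {0<..x}))"
      by (rule negligible_subset[of "{0}"]) auto
    have "integral {0<..x} h = integral {0..x} h"
      by (rule integral_spike_set) (rule negligible_subset[OF neg], force)+
    moreover have "h integrable_on {0..x}"
      by (rule integrable_spike_set[OF *(1)]) (rule negligible_subset[OF neg], force)+
    ultimately show ?thesis using * by simp
  qed
  have "((\<lambda>x. \<integral>t. indicator {..x} t *\<^sub>R (indicator {0<..} t *\<^sub>R h t) \<partial>lborel)
      \<longlongrightarrow> (LINT t:{0<..}|lborel. h t)) at_top"
    unfolding set_lebesgue_integral_def
    by (rule tendsto_integral_at_top) (use assms in \<open>auto simp: set_integrable_def\<close>)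
  moreover have "(\<integral>t. indicator {..x} t *\<^sub>R (indicator {0<..} t *\<^sub>R h t) \<partial>lborel)
      = (LINT t:{0<..x}|lborel. h t)" for x
    unfolding set_lebesgue_integral_def
    by (intro Bochner_Integration.integral_cong) (auto simp: indicator_def)
  ultimately show "((\<lambda>x. integral {0..x} h) \<longlongrightarrow> (LINT t:{0<..}|lborel. h t)) at_top"
    using eq by simp
  show "h integrable_on {0..x}" using eq by simp
qed

section \<open>Convergence of the Laplace integral\<close>

lemma borel_measurable_bounded_integrable_on:
  fixes g :: "real \<Rightarrow> real"
  assumes [measurable]: "g \<in> borel_measurable borel" and "\<And>t. t \<in> {p..q} \<Longrightarrow> \<bar>g t\<bar> \<le> M"
  shows "g integrable_on {p..q}"
proof -
  have "set_integrable lborel {p..q} g"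
    unfolding set_integrable_def
    by (rule integrableI_bounded_set_indicator[where B = M]) (use assms in \<open>auto simp: emeasure_lborel_Icc_eq\<close>)
  then show ?thesis by (rule set_borel_integral_eq_integral)
qed

lemma abs_ln_le_exp:
  fixes y :: real
  assumes "0 < B" "B \<le> t" "y > 0"
  shows "\<bar>ln t\<bar> \<le> \<bar>ln B\<bar> + exp (y * t) / y"
proof -
  have "y * t \<le> exp (y * t)" using exp_ge_add_one_self[of "y * t"] by linarith
  then have "t \<le> exp (y * t) / y" using assms by (simp add: field_simps)
  moreover have "ln B \<le> ln t" using assms by simp
  moreover have "ln t \<le> t - 1" using assms by (intro ln_le_minus_one) auto
  ultimately show ?thesis using assms by linarith
qed

lemma has_integral_exp_minus:
  fixes y :: real
  assumes "p \<le> q"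
  shows "((\<lambda>t. y * exp (- y * t)) has_integral (exp (- y * p) - exp (- y * q))) {p..q}"
proof -
  have "((\<lambda>t. y * exp (- y * t)) has_integral (- exp (- y * q) - (- exp (- y * p)))) {p..q}"
    using assms
    by (intro fundamental_theorem_of_calculus)
       (auto simp flip: has_real_derivative_iff_has_vector_derivative intro!: derivative_eq_intros)
  then show ?thesis by simp
qed

text \<open>The integrated-by-parts form of the Stieltjes integral of \<open>exp (- y * t)\<close>
  against \<open>g\<close> over \<open>[0, x]\<close> when \<open>g 0 = 0\<close>. It also makes
  sense for \<open>g = ln\<close>, whose singularity at the origin is integrable although
  \<open>ln\<close> is unbounded there.\<close>

definition laplace_primitive :: "(real \<Rightarrow> real) \<Rightarrow> real \<Rightarrow> real \<Rightarrow> real" where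
  "laplace_primitive g y x = exp (- y * x) * g x + y * integral {0..x} (\<lambda>t. g t * exp (- y * t))"

text \<open>Formally, the integral of \<open>exp (- y * t)\<close> against a nondecreasing
  \<open>g\<close> over \<open>[x, x']\<close> is at least the smallest weight times the increment.
  By parts, this is the estimate \<open>g t \<ge> g x\<close> under the integral. It yields
  monotonicity of the primitive and, read backwards, a growth bound for \<open>g\<close>.\<close>

lemma laplace_primitive_diff_ge:
  assumes x: "0 \<le> x" "x \<le> x'" and y: "y > 0"
    and int: "(\<lambda>t. g t * exp (- y * t)) integrable_on {0..x'}"
    and mono: "\<And>t. x \<le> t \<Longrightarrow> t \<le> x' \<Longrightarrow> g x \<le> g t"
  shows "exp (- y * x') * (g x' - g x) \<le> laplace_primitive g y x' - laplace_primitive g y x"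
proof -
  let ?h = "\<lambda>t. g t * exp (- y * t)"
  have hi: "?h integrable_on {x..x'}"
    using x by (intro integrable_subinterval_real[OF int]) auto
  have "g x * (exp (- y * x) - exp (- y * x')) = integral {x..x'} (\<lambda>t. g x * (y * exp (- y * t)))"
    by (rule integral_unique[OF has_integral_mult_right[OF has_integral_exp_minus[OF x(2)]], symmetric])
  also have "\<dots> \<le> integral {x..x'} (\<lambda>t. y * ?h t)"
  proof (rule integral_le)
    show "(\<lambda>t. g x * (y * exp (- y * t))) integrable_on {x..x'}"
      using has_integral_mult_right[OF has_integral_exp_minus[OF x(2)]] by blast
    show "(\<lambda>t. y * ?h t) integrable_on {x..x'}"
      using hi by (rule integrable_on_mult_right)
    show "g x * (y * exp (- y * t)) \<le> y * ?h t" if "t \<in> {x..x'}" for t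
      using mono[of t] that y by simp
  qed
  also have "\<dots> = y * integral {x..x'} ?h" by simp
  finally have "g x * (exp (- y * x) - exp (- y * x')) \<le> y * integral {x..x'} ?h" .
  moreover have "integral {0..x} ?h + integral {x..x'} ?h = integral {0..x'} ?h"
    using x int by (intro Henstock_Kurzweil_Integration.integral_combine) auto
  then have "y * integral {0..x'} ?h = y * integral {0..x} ?h + y * integral {x..x'} ?h"
    by (metis distrib_left)
  ultimately show ?thesis
    unfolding laplace_primitive_def by (simp add: algebra_simps)
qed

lemma laplace_primitive_add:
  assumes "(\<lambda>t. g t * exp (- y * t)) integrable_on {0..x}" "(\<lambda>t. h t * exp (- y * t)) integrable_on {0..x}"
  shows "laplace_primitive (\<lambda>t. g t + c * h t) y x = laplace_primitive g y x + c * laplace_primitive h y x"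
proof -
  have "integral {0..x} (\<lambda>t. (g t + c * h t) * exp (- y * t))
      = integral {0..x} (\<lambda>t. g t * exp (- y * t) + c * (h t * exp (- y * t)))"
    by (simp add: algebra_simps)
  also have "\<dots> = integral {0..x} (\<lambda>t. g t * exp (- y * t)) + c * integral {0..x} (\<lambda>t. h t * exp (- y * t))"
    using assms by (subst Henstock_Kurzweil_Integration.integral_add) (auto intro: integrable_on_mult_right)
  finally show ?thesis
    unfolding laplace_primitive_def by (simp add: algebra_simps)
qed

text \<open>The boundary term dies, and \<open>y\<close> times the Laplace integral is the Abel mean
  at \<open>1 / y\<close> by the substitution \<open>t = u / y\<close>.\<close>

lemma laplace_primitive_tendsto:
  assumes [measurable]: "g \<in> borel_measurable borel"
    and "y > 0" "integrable exp_measure (\<lambda>u. g (u / y))"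
    and "((\<lambda>x. exp (- y * x) * g x) \<longlongrightarrow> 0) at_top"
  shows "(laplace_primitive g y \<longlongrightarrow> abel_mean g (1 / y)) at_top"
proof -
  have "set_integrable lborel {0<..} (\<lambda>t. g t * exp (- y * t))"
    using exp_measure_scale(1)[of g y] assms by simp
  then have "((\<lambda>x. integral {0..x} (\<lambda>t. g t * exp (- y * t)))
      \<longlongrightarrow> (LINT t:{0<..}|lborel. g t * exp (- y * t))) at_top"
    by (rule integral_tendsto_at_top)
  from tendsto_add[OF assms(4) tendsto_mult[OF tendsto_const[of y] this]]
  have "(laplace_primitive g y \<longlongrightarrow> y * (LINT t:{0<..}|lborel. g t * exp (- y * t))) at_top"
    unfolding laplace_primitive_def[abs_def] by simp
  moreover have "y * (LINT t:{0<..}|lborel. g t * exp (- y * t)) = abel_mean g (1 / y)"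
    using exp_measure_scale(2)[of g y] assms by (simp add: abel_mean_def)
  ultimately show ?thesis by simp
qed

lemma integrable_ln_scale:
  assumes "c > 0"
  shows "integrable exp_measure (\<lambda>u. ln (c * u))"
    and "(\<integral>u. ln (c * u) \<partial>exp_measure) = ln c - euler_mascheroni"
proof -
  have ae: "AE u in exp_measure. ln c + ln u = ln (c * u)"
    using AE_exp_measure_pos by eventually_elim (use assms in \<open>auto simp: ln_mult\<close>)
  have "integrable exp_measure (\<lambda>u. ln c + ln u)"
    using integrable_exp_measure_ln by simp
  then show "integrable exp_measure (\<lambda>u. ln (c * u))"
    by (rule Bochner_Integration.integrable_cong_AE_imp) (use ae in auto)
  have "(\<integral>u. ln (c * u) \<partial>exp_measure) = (\<integral>u. ln c + ln u \<partial>exp_measure)"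
    using ae by (intro integral_cong_AE) auto
  also have "\<dots> = ln c - euler_mascheroni"
    using integrable_exp_measure_ln
    by (simp add: integral_exp_measure_ln measure_exp_measure_UNIV)
  finally show "(\<integral>u. ln (c * u) \<partial>exp_measure) = ln c - euler_mascheroni" .
qed

lemma integrable_on_ln_exp:
  fixes x y :: real
  assumes "y > 0"
  shows "(\<lambda>t. ln t * exp (- y * t)) integrable_on {0..x}"
proof (rule integral_tendsto_at_top(2))
  show "set_integrable lborel {0<..} (\<lambda>t. ln t * exp (- y * t))"
    using exp_measure_scale(1)[of ln y] integrable_ln_scale(1)[of "1 / y"] assms by simp
qed

section \<open>Partial Laplace integrals of a function with a monotone majorant\<close>

locale bv_majorized =
  fixes s V :: "real \<Rightarrow> real"
  assumes majorant: "\<And>x y. x \<le> y \<Longrightarrow> \<bar>s y - s x\<bar> \<le> V y - V x"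
begin

definition s0 :: "real \<Rightarrow> real" where "s0 t = s t - s 0"

text \<open>Jordan decomposition: the majorant makes both \<open>V\<close> and \<open>V - s\<close>
  monotone, hence Borel.\<close>

lemma measurable_s0 [measurable]: "s0 \<in> borel_measurable borel"
proof -
  have "mono V"
    by (rule monoI) (use majorant in fastforce)
  moreover have "mono (\<lambda>t. V t - s t)"
    by (rule monoI) (use majorant in fastforce)
  ultimately have [measurable]: "V \<in> borel_measurable borel" "(\<lambda>t. V t - s t) \<in> borel_measurable borel"
    using borel_measurable_mono by blast+
  have "s0 = (\<lambda>t. V t - (V t - s t) - s 0)" by (auto simp: s0_def)
  also have "\<dots> \<in> borel_measurable borel" by measurable
  finally show ?thesis .
qed

lemma s0_bound: "0 \<le> t \<Longrightarrow> t \<le> X \<Longrightarrow> \<bar>s0 t\<bar> \<le> V X - V 0"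
  using majorant[of 0 t] majorant[of t X] by (simp add: s0_def)

lemma integrable_on_s0_kernel:
  assumes [measurable]: "h \<in> borel_measurable borel" and "\<And>t. t \<in> {0..x} \<Longrightarrow> \<bar>h t\<bar> \<le> M" and "0 \<le> x"
  shows "(\<lambda>t. s0 t * h t) integrable_on {0..x}"
proof (rule borel_measurable_bounded_integrable_on)
  have "V x - V 0 \<ge> 0" using s0_bound[of 0 x] assms by simp
  then show "\<bar>s0 t * h t\<bar> \<le> (V x - V 0) * M" if "t \<in> {0..x}" for t
    unfolding abs_mult using s0_bound[of t x] assms(2)[OF that] that by (intro mult_mono) auto
qed measurable

lemma integrable_on_s0_exp:
  assumes "0 \<le> x" "y \<ge> 0"
  shows "(\<lambda>t. s0 t * exp (- y * t)) integrable_on {0..x}"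
  by (rule integrable_on_s0_kernel[where M = 1]) (use assms in auto)

lemma partial_laplace_eq:
  assumes x: "0 \<le> x" and y: "y > 0"
  shows "partial_laplace s y x = laplace_primitive s0 y x"
proof -
  have "has_RS_integral (\<lambda>t. exp (- y * t)) s0 0 x (exp (- y * x) * s0 x - exp (- y * 0) * s0 0
      - integral {0..x} (\<lambda>t. s0 t * (- y * exp (- y * t))))"
  proof (rule has_RS_integral_by_parts[where V = V and K = y])
    show "((\<lambda>t. exp (- y * t)) has_real_derivative - y * exp (- y * t)) (at t within {0..x})" for t
      by (auto intro!: derivative_eq_intros)
    show "\<bar>- y * exp (- y * t)\<bar> \<le> y" if "t \<in> {0..x}" for t
      using that y by (simp add: abs_mult)
    have "(\<lambda>t. (- y) * (s0 t * exp (- y * t))) integrable_on {0..x}"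
      by (intro integrable_on_mult_right integrable_on_s0_exp) (use x y in auto)
    then show "(\<lambda>t. s0 t * (- y * exp (- y * t))) integrable_on {0..x}"
      by (simp add: mult_ac)
  qed (use x majorant in \<open>auto simp: s0_def\<close>)
  moreover have "integral {0..x} (\<lambda>t. s0 t * (- y * exp (- y * t)))
      = - y * integral {0..x} (\<lambda>t. s0 t * exp (- y * t))"
    by (simp add: mult_ac flip: integral_mult_right)
  ultimately have "has_RS_integral (\<lambda>t. exp (- y * t)) s0 0 x (laplace_primitive s0 y x)"
    by (simp add: laplace_primitive_def s0_def)
  \<comment> \<open>Riemann-Stieltjes sums involve only increments, which \<open>s\<close> and
    \<open>s0\<close> share.\<close>
  then have "has_RS_integral (\<lambda>t. exp (- y * t)) s 0 x (laplace_primitive s0 y x)"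
    by (simp add: has_RS_integral_def s0_def)
  then show ?thesis
    using x by (simp add: partial_laplace_def RS_integral_eq)
qed

lemma continuous_on_s0_integral:
  assumes "0 \<le> x" "y > 0"
  shows "continuous_on {0..x} (\<lambda>t. integral {0..t} (\<lambda>r. s0 r * exp (- y * r)))"
  using integrable_on_s0_exp[of x y] assms by (intro indefinite_integral_continuous_1) auto

text \<open>Supplies the integrability needed for the Cesaro comparison: the boundary term is
  bounded and measurable, the integral term is continuous in its upper limit.\<close>

lemma partial_laplace_integrable_on:
  assumes x: "0 \<le> x" and y: "y > 0"
  shows "(\<lambda>t. (x - t) ^ m * partial_laplace s y t) integrable_on {0..x}"
proof -
  let ?H = "\<lambda>t. integral {0..t} (\<lambda>r. s0 r * exp (- y * r))"
  have "(\<lambda>t. s0 t * ((x - t) ^ m * exp (- y * t))) integrable_on {0..x}"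
  proof (rule integrable_on_s0_kernel[where M = "x ^ m * 1"])
    show "\<bar>(x - t) ^ m * exp (- y * t)\<bar> \<le> x ^ m * 1" if "t \<in> {0..x}" for t
      unfolding abs_mult using that y by (intro mult_mono) (auto intro!: power_mono simp: power_abs)
  qed (use x in auto)
  moreover have "(\<lambda>t. (x - t) ^ m * (y * ?H t)) integrable_on {0..x}"
    by (intro integrable_continuous_real continuous_intros continuous_on_s0_integral x y)
  ultimately have "(\<lambda>t. s0 t * ((x - t) ^ m * exp (- y * t)) + (x - t) ^ m * (y * ?H t)) integrable_on {0..x}"
    by (rule Henstock_Kurzweil_Integration.integrable_add)
  then show ?thesis
    by (rule integrable_eq) (use y in \<open>simp add: partial_laplace_eq laplace_primitive_def algebra_simps\<close>)
qed

lemma partial_laplace_locally_bounded: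
  assumes x: "0 \<le> x" and y: "y > 0"
  shows "\<exists>M. \<forall>t\<in>{0..x}. \<bar>partial_laplace s y t\<bar> \<le> M"
proof -
  let ?H = "\<lambda>t. integral {0..t} (\<lambda>r. s0 r * exp (- y * r))"
  have "bounded (?H ` {0..x})"
    by (intro compact_imp_bounded compact_continuous_image continuous_on_s0_integral x y) auto
  then obtain M where "\<forall>z \<in> ?H ` {0..x}. norm z \<le> M"
    unfolding bounded_iff by blast
  then have M: "\<bar>?H t\<bar> \<le> M" if "t \<in> {0..x}" for t
    using that by simp
  have "\<bar>partial_laplace s y t\<bar> \<le> 1 * (V x - V 0) + y * M" if t: "t \<in> {0..x}" for t
  proof -
    have "\<bar>exp (- y * t) * s0 t\<bar> \<le> 1 * (V x - V 0)"
      unfolding abs_mult using t y s0_bound[of t x] by (intro mult_mono) auto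
    moreover have "\<bar>y * ?H t\<bar> \<le> y * M"
      unfolding abs_mult using M[OF t] y by (intro mult_mono) auto
    ultimately show ?thesis
      using t y by (simp add: partial_laplace_eq laplace_primitive_def)
  qed
  then show ?thesis by blast
qed

end

section \<open>From Cesaro summability to growth bounds and ordinary convergence\<close>

locale log_tauberian = bv_majorized +
  fixes A B :: real and L :: "real \<Rightarrow> real"
  assumes A: "A > 0" and B: "B > 0"
    and mono: "mono_on {B..} (\<lambda>x. s x + A * ln x)"
    and lap: "\<And>y. y > 0 \<Longrightarrow> laplace_C s y (L y)"
begin

lemma s0_log_mono: "B \<le> x \<Longrightarrow> x \<le> t \<Longrightarrow> s0 x + A * ln x \<le> s0 t + A * ln t"
  using mono_onD[OF mono, of x t] by (simp add: s0_def)

text \<open>From \<open>B\<close> on, \<open>\<tau> = s0 + A * ln\<close> is nondecreasing, hence so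
  is its Laplace primitive, and the Cesaro limit forces that primitive to stay below
  \<open>L y + A * e\<close>. The increment inequality started at \<open>B\<close> then bounds
  \<open>exp (- y * t) * (\<tau> t - \<tau> B)\<close>.\<close>

lemma s0_exponential_bound:
  assumes y: "y > 0"
  shows "\<exists>C. \<forall>t>0. \<bar>s0 t\<bar> \<le> C * exp (y * t)"
proof -
  define \<tau> where "\<tau> t = s0 t + A * ln t" for t
  obtain k where ces: "cesaro_lim (partial_laplace s y) k (L y)"
    using lap[OF y] by (auto simp: laplace_C_def)
  define e where "e = abel_mean ln (1 / y)"
  have E: "(laplace_primitive ln y \<longlongrightarrow> e) at_top"
    unfolding e_def
  proof (rule laplace_primitive_tendsto)
    show "((\<lambda>x. exp (- y * x) * ln x) \<longlongrightarrow> 0) at_top"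
      using y by real_asymp
    show "integrable exp_measure (\<lambda>u. ln (u / y))"
      using integrable_ln_scale(1)[of "1 / y"] y by simp
  qed (use y in auto)
  have tau_int: "(\<lambda>t. \<tau> t * exp (- y * t)) integrable_on {0..x}" if "x \<ge> 0" for x
  proof -
    have "(\<lambda>t. s0 t * exp (- y * t) + A * (ln t * exp (- y * t))) integrable_on {0..x}"
      using that y
      by (intro Henstock_Kurzweil_Integration.integrable_add integrable_on_mult_right
            integrable_on_s0_exp integrable_on_ln_exp) auto
    then show ?thesis by (simp add: \<tau>_def algebra_simps)
  qed
  have M: "laplace_primitive \<tau> y x = partial_laplace s y x + A * laplace_primitive ln y x" if "x \<ge> 0" for x
    unfolding \<tau>_def partial_laplace_eq[OF that y]
    by (intro laplace_primitive_add integrable_on_s0_exp integrable_on_ln_exp) (use that y in auto)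
  have incr: "exp (- y * x') * (\<tau> x' - \<tau> x) \<le> laplace_primitive \<tau> y x' - laplace_primitive \<tau> y x"
    if "B \<le> x" "x \<le> x'" for x x'
    using that B y by (intro laplace_primitive_diff_ge tau_int) (auto simp: \<tau>_def intro!: s0_log_mono)
  have incr0: "laplace_primitive \<tau> y x \<le> laplace_primitive \<tau> y x'" if "B \<le> x" "x \<le> x'" for x x'
  proof -
    have "0 \<le> exp (- y * x') * (\<tau> x' - \<tau> x)"
      using s0_log_mono[OF that] by (simp add: \<tau>_def)
    then show ?thesis using incr[OF that] by linarith
  qed
  have bound: "laplace_primitive \<tau> y x \<le> L y + A * e" if x: "B \<le> x" for x
  proof (rule ccontr)
    assume contra: "\<not> laplace_primitive \<tau> y x \<le> L y + A * e"
    \<comment> \<open>An excess of \<open>2 * \<epsilon>\<close> at \<open>x\<close> persists by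
      monotonicity. One \<open>\<epsilon>\<close> absorbs the convergence of the logarithmic part;
      the other keeps the partial Laplace integral eventually above its own Cesaro limit.\<close>
    define \<epsilon> where "\<epsilon> = (laplace_primitive \<tau> y x - (L y + A * e)) / 2"
    have two: "laplace_primitive \<tau> y x = L y + A * e + 2 * \<epsilon>" by (simp add: \<epsilon>_def field_simps)
    have \<epsilon>: "\<epsilon> > 0" using contra by (simp add: \<epsilon>_def)
    have "((\<lambda>x. A * laplace_primitive ln y x) \<longlongrightarrow> A * e) at_top"
      by (intro tendsto_mult tendsto_const E)
    then have "\<forall>\<^sub>F z in at_top. A * laplace_primitive ln y z < A * e + \<epsilon>"
      using \<epsilon> by (intro order_tendstoD(2)) auto
    then have "\<forall>\<^sub>F z in at_top. L y + \<epsilon> \<le> partial_laplace s y z"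
      using eventually_ge_at_top[of x]
    proof eventually_elim
      case (elim z)
      then show ?case
        using M[of z] incr0[OF x elim(2)] x B two by simp
    qed
    then have "L y + \<epsilon> \<le> L y"
      using y by (intro cesaro_lim_lower_bound[OF ces])
        (auto intro: partial_laplace_integrable_on partial_laplace_locally_bounded)
    then show False using \<epsilon> by simp
  qed
  define C where "C = L y + A * e - laplace_primitive \<tau> y B"
  have C0: "C \<ge> 0" using bound[of B] by (simp add: C_def)
  have tau_bound: "\<bar>\<tau> t\<bar> \<le> \<bar>\<tau> B\<bar> + C * exp (y * t)" if "t \<ge> B" for t
  proof -
    have "exp (- y * t) * (\<tau> t - \<tau> B) \<le> C"
      using incr[of B t] bound[of t] that by (simp add: C_def)
    then have "exp (y * t) * (exp (- y * t) * (\<tau> t - \<tau> B)) \<le> exp (y * t) * C"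
      by (intro mult_left_mono) auto
    then have "\<tau> t - \<tau> B \<le> C * exp (y * t)"
      by (simp add: mult.assoc[symmetric] mult.commute flip: exp_add)
    moreover have "\<tau> B \<le> \<tau> t" using s0_log_mono[of B t] that by (simp add: \<tau>_def)
    ultimately show ?thesis by linarith
  qed
  \<comment> \<open>The first summand covers \<open>t < B\<close>; the others collect the bound for
    \<open>\<tau>\<close> and the exponential bound for \<open>A * ln t\<close> when
    \<open>t \<ge> B\<close>.\<close>
  define D where "D = V B - V 0 + \<bar>\<tau> B\<bar> + C + A * \<bar>ln B\<bar> + A / y"
  have V0: "V B - V 0 \<ge> 0" using s0_bound[of 0 B] B by simp
  have "\<bar>s0 t\<bar> \<le> D * exp (y * t)" if t: "t > 0" for t
  proof -
    have e1: "1 \<le> exp (y * t)" using t y by simp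
    have key: "x \<le> x * exp (y * t)" if "x \<ge> 0" for x
      using mult_left_mono[OF e1 that] by simp
    have De: "D * exp (y * t) = (V B - V 0) * exp (y * t) + \<bar>\<tau> B\<bar> * exp (y * t) + C * exp (y * t)
        + A * \<bar>ln B\<bar> * exp (y * t) + A / y * exp (y * t)"
      by (simp add: D_def algebra_simps)
    have nn: "0 \<le> C * exp (y * t)" "0 \<le> A / y * exp (y * t)" "0 \<le> A * \<bar>ln B\<bar>"
      using C0 A y by auto
    note k1 = key[OF V0] and k2 = key[OF abs_ge_zero[of "\<tau> B"]] and k3 = key[OF nn(3)]
    show ?thesis
    proof (cases "t \<ge> B")
      case True
      have "A * \<bar>ln t\<bar> \<le> A * (\<bar>ln B\<bar> + exp (y * t) / y)"
        using A abs_ln_le_exp[OF B True y] by (intro mult_left_mono) auto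
      then have "\<bar>A * ln t\<bar> \<le> A * \<bar>ln B\<bar> + A / y * exp (y * t)"
        using A by (simp add: abs_mult distrib_left)
      moreover have "\<bar>s0 t\<bar> \<le> \<bar>\<tau> t\<bar> + \<bar>A * ln t\<bar>" by (simp add: \<tau>_def)
      ultimately show ?thesis
        using tau_bound[OF True] k1 k2 k3 nn V0 unfolding De by linarith
    next
      case False
      then show ?thesis
        using s0_bound[of t B] t k1 k2 k3 nn unfolding De by linarith
    qed
  qed
  then show ?thesis by blast
qed

lemma subexponential_s0: "subexponential s0"
  using s0_exponential_bound by (auto simp: subexponential_def)

text \<open>The growth bound at rate \<open>y / 2\<close> kills the boundary term and makes the
  Laplace integral converge in the ordinary sense; the Cesaro value must agree with that
  limit.\<close>

lemma laplace_eq_abel_mean: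
  assumes y: "y > 0"
  shows "L y = abel_mean s0 (1 / y)"
proof -
  obtain k where ces: "cesaro_lim (partial_laplace s y) k (L y)"
    using lap[OF y] by (auto simp: laplace_C_def)
  have lim: "(laplace_primitive s0 y \<longlongrightarrow> abel_mean s0 (1 / y)) at_top"
  proof (rule laplace_primitive_tendsto)
    show "integrable exp_measure (\<lambda>u. s0 (u / y))"
      using integrable_subexponential[OF measurable_s0 subexponential_s0, of "1 / y"] y by simp
    obtain C where C: "\<And>t. t > 0 \<Longrightarrow> \<bar>s0 t\<bar> \<le> C * exp (y / 2 * t)"
      using s0_exponential_bound[of "y / 2"] y by auto
    show "((\<lambda>x. exp (- y * x) * s0 x) \<longlongrightarrow> 0) at_top"
    proof (rule Lim_null_comparison)
      show "((\<lambda>x. C * exp (- (y / 2) * x)) \<longlongrightarrow> 0) at_top"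
        using y by real_asymp
      show "\<forall>\<^sub>F x in at_top. norm (exp (- y * x) * s0 x) \<le> C * exp (- (y / 2) * x)"
        using eventually_gt_at_top[of 0]
      proof eventually_elim
        case (elim x)
        have "exp (- y * x) * \<bar>s0 x\<bar> \<le> exp (- y * x) * (C * exp (y / 2 * x))"
          using C[OF elim] by (intro mult_left_mono) auto
        also have "\<dots> = C * exp (- y * x + y / 2 * x)"
          by (simp only: exp_add mult_ac)
        also have "- y * x + y / 2 * x = - (y / 2) * x" by simp
        finally show ?case by (simp add: abs_mult)
      qed
    qed
  qed (use y in auto)
  have "(partial_laplace s y \<longlongrightarrow> abel_mean s0 (1 / y)) at_top"
    using lim
  proof (rule Lim_transform_eventually)
    show "\<forall>\<^sub>F x in at_top. laplace_primitive s0 y x = partial_laplace s y x"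
      using eventually_ge_at_top[of 0] by eventually_elim (simp add: partial_laplace_eq y)
  qed
  then show ?thesis
    using y by (intro cesaro_lim_unique[OF ces])
      (auto intro: partial_laplace_integrable_on partial_laplace_locally_bounded)
qed

end

section \<open>The logarithmic remainder\<close>

lemma bounded_of_subexponential_tendsto_0:
  assumes "subexponential f" "(f \<longlongrightarrow> 0) at_top"
  obtains K where "\<And>t. t > 0 \<Longrightarrow> \<bar>f t\<bar> \<le> K"
proof -
  obtain X where X: "\<And>x. x \<ge> X \<Longrightarrow> \<bar>f x\<bar> < 1"
    using tendsto_0_at_topE[OF assms(2) zero_less_one] by blast
  obtain C where C: "\<And>t. 0 < t \<Longrightarrow> t \<le> X \<Longrightarrow> \<bar>f t\<bar> \<le> C"
    using subexponential_bounded_initial[OF assms(1)] by blast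
  have "\<bar>f t\<bar> \<le> max 1 C" if "t > 0" for t
    using X[of t] C[of t] that by linarith
  then show ?thesis by (rule that)
qed

context log_tauberian
begin

definition remainder :: "real \<Rightarrow> real \<Rightarrow> real \<Rightarrow> real" where
  "remainder c b t = s0 t - c - b * ln t"

lemma measurable_remainder [measurable]: "remainder c b \<in> borel_measurable borel"
  unfolding remainder_def[abs_def] by measurable

lemma
  assumes "x > 0"
  shows integrable_remainder: "integrable exp_measure (\<lambda>u. remainder c b (x * u))"
    and abel_mean_remainder:
      "abel_mean (remainder c b) x = L (1 / x) - c - b * (ln x - euler_mascheroni)"
proof -
  have 1: "integrable exp_measure (\<lambda>u. s0 (x * u))"
    using assms by (intro integrable_subexponential[OF measurable_s0 subexponential_s0])
  have 2: "integrable exp_measure (\<lambda>u. ln (x * u))"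
    using assms by (rule integrable_ln_scale)
  show "integrable exp_measure (\<lambda>u. remainder c b (x * u))"
    unfolding remainder_def using 1 2 by auto
  have "abel_mean (remainder c b) x = abel_mean s0 x - c - b * (\<integral>u. ln (x * u) \<partial>exp_measure)"
    unfolding abel_mean_def remainder_def using 1 2
    by (simp add: measure_exp_measure_UNIV)
  then show "abel_mean (remainder c b) x = L (1 / x) - c - b * (ln x - euler_mascheroni)"
    using assms laplace_eq_abel_mean[of "1 / x"] integrable_ln_scale(2)[of x] by simp
qed

text \<open>The singularity of the logarithm at the origin is removed by freezing the remainder on
  \<open>(0, B)\<close>; what is frozen is invisible to both limits.\<close>

definition truncated :: "real \<Rightarrow> real \<Rightarrow> real \<Rightarrow> real" where
  "truncated c b t = remainder c b (max t B)"

lemma measurable_truncated [measurable]: "truncated c b \<in> borel_measurable borel"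
  unfolding truncated_def[abs_def] by measurable

lemma truncated_tendsto_iff:
  "(truncated c b \<longlongrightarrow> 0) at_top \<longleftrightarrow> (remainder c b \<longlongrightarrow> 0) at_top"
proof (rule filterlim_cong[OF refl refl])
  show "\<forall>\<^sub>F x in at_top. truncated c b x = remainder c b x"
    using eventually_ge_at_top[of B] by eventually_elim (simp add: truncated_def max_def)
qed

lemma abs_ln_max_le:
  assumes "t > 0" "y > 0"
  shows "\<bar>ln (max t B)\<bar> \<le> \<bar>ln B\<bar> + exp (y * t) / y"
proof (cases "t \<ge> B")
  case True
  then show ?thesis
    using abs_ln_le_exp[OF B True assms(2)] by (simp only: max_absorb1)
next
  case False
  then show ?thesis using assms by simp
qed

lemma subexponential_truncated: "subexponential (truncated c b)"
  unfolding subexponential_def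
proof (intro allI impI)
  fix y :: real assume y: "y > 0"
  obtain C where C0: "C \<ge> 0" and C: "\<And>t. t > 0 \<Longrightarrow> \<bar>s0 t\<bar> \<le> C * exp (y * t)"
    using subexponentialE[OF subexponential_s0 y] by blast
  define D where "D = C * exp (y * B) + \<bar>c\<bar> + \<bar>b\<bar> * (\<bar>ln B\<bar> + 1 / y)"
  have "\<bar>truncated c b t\<bar> \<le> D * exp (y * t)" if t: "t > 0" for t
  proof -
    have e1: "1 \<le> exp (y * t)" using t y by simp
    have "\<bar>s0 (max t B)\<bar> \<le> C * exp (y * max t B)"
      using t by (intro C) auto
    \<comment> \<open>Since \<open>max t B \<le> B + t\<close>, freezing below \<open>B\<close>
      costs only the constant factor \<open>exp (y * B)\<close>.\<close>
    also have "\<dots> \<le> C * exp (y * B + y * t)"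
      using y t B C0 by (intro mult_left_mono) (auto simp: max_def)
    finally have "\<bar>s0 (max t B)\<bar> \<le> C * exp (y * B) * exp (y * t)"
      by (simp add: exp_add)
    moreover have "\<bar>c\<bar> \<le> \<bar>c\<bar> * exp (y * t)"
      using mult_left_mono[OF e1 abs_ge_zero[of c]] by simp
    moreover have "\<bar>b * ln (max t B)\<bar> \<le> \<bar>b\<bar> * (\<bar>ln B\<bar> + 1 / y) * exp (y * t)"
    proof -
      have "\<bar>ln B\<bar> \<le> \<bar>ln B\<bar> * exp (y * t)"
        using mult_left_mono[OF e1 abs_ge_zero[of "ln B"]] by simp
      then have "\<bar>ln (max t B)\<bar> \<le> (\<bar>ln B\<bar> + 1 / y) * exp (y * t)"
        using abs_ln_max_le[OF t y] by (simp add: distrib_right)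
      then have "\<bar>b\<bar> * \<bar>ln (max t B)\<bar> \<le> \<bar>b\<bar> * ((\<bar>ln B\<bar> + 1 / y) * exp (y * t))"
        by (intro mult_left_mono) auto
      then show ?thesis by (simp add: abs_mult mult.assoc)
    qed
    moreover have "D * exp (y * t) = C * exp (y * B) * exp (y * t) + \<bar>c\<bar> * exp (y * t)
        + \<bar>b\<bar> * (\<bar>ln B\<bar> + 1 / y) * exp (y * t)"
      by (simp add: D_def distrib_right)
    ultimately show ?thesis
      unfolding truncated_def remainder_def by linarith
  qed
  then show "\<exists>C. \<forall>t>0. \<bar>truncated c b t\<bar> \<le> C * exp (y * t)" by blast
qed

text \<open>The map \<open>t \<mapsto> max t B\<close> contracts logarithmic distances, that is
  \<open>max t B / max x B \<le> t / x\<close>, so the condition on \<open>[B, \<infinity>)\<close>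
  carries over to the whole positive axis. The term \<open>- b * ln t\<close> adds at most
  \<open>\<bar>b\<bar>\<close> to the slope.\<close>

lemma slowly_decreasing_truncated: "slowly_decreasing (truncated c b) (A + \<bar>b\<bar>)"
proof
  fix x t :: real assume xt: "0 < x" "x \<le> t"
  define x' t' where "x' = max x B" and "t' = max t B"
  have x't': "B \<le> x'" "x' \<le> t'" "0 < x'" using xt B by (auto simp: x'_def t'_def)
  have ln0: "0 \<le> ln (t' / x')" using x't' by simp
  have "t' * x \<le> t * x'"
  proof (cases "t \<ge> B")
    case True
    then show ?thesis 
      using xt unfolding t'_def x'_def max_absorb1[OF True] by (intro mult_left_mono) auto
  next
    case False
    then show ?thesis using xt B by (simp add: t'_def x'_def max_def mult.commute)
  qed
  then have "t' / x' \<le> t / x"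
    using xt x't' by (simp add: divide_le_eq pos_le_divide_eq)
  then have "ln (t' / x') \<le> ln (t / x)"
    using x't' xt by (subst ln_le_cancel_iff) auto
  then have "(A + b) * ln (t' / x') \<le> (A + \<bar>b\<bar>) * ln (t / x)"
    using ln0 A by (intro mult_mono) auto
  moreover have "ln (t' / x') = ln t' - ln x'" using x't' by (simp add: ln_div)
  moreover have "s0 x' + A * ln x' \<le> s0 t' + A * ln t'"
    using x't' by (intro s0_log_mono) auto
  ultimately show "truncated c b x - (A + \<bar>b\<bar>) * ln (t / x) \<le> truncated c b t"
    unfolding truncated_def remainder_def x'_def[symmetric] t'_def[symmetric]
    by (simp add: algebra_simps)
qed (use A subexponential_truncated in auto)

text \<open>Dominated convergence: the difference \<open>d\<close> vanishes on
  \<open>[B, \<infinity>)\<close>, so \<open>d (x * u) = 0\<close> once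
  \<open>x \<ge> B / u\<close>. When \<open>x \<ge> 1\<close> and \<open>x * u < B\<close>, the
  inequalities \<open>u \<le> x * u \<le> B\<close> bound \<open>\<bar>ln (x * u)\<bar>\<close> by
  \<open>\<bar>ln B\<bar> + \<bar>ln u\<bar>\<close>, independently of \<open>x\<close>.\<close>

lemma abel_mean_truncated_diff:
  "((\<lambda>x. abel_mean (remainder c b) x - abel_mean (truncated c b) x) \<longlongrightarrow> 0) at_top"
proof -
  define d where "d t = remainder c b t - truncated c b t" for t
  have [measurable]: "d \<in> borel_measurable borel" unfolding d_def[abs_def] by measurable
  define W where "W = V B - V 0 + \<bar>c\<bar> + \<bar>truncated c b B\<bar> + \<bar>b\<bar> * \<bar>ln B\<bar>"
  have "((\<lambda>x. \<integral>u. d (x * u) \<partial>exp_measure) \<longlongrightarrow> (\<integral>u. 0 \<partial>exp_measure)) at_top"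
  proof (rule integral_dominated_convergence_at_top)
    show "integrable exp_measure (\<lambda>u. W + \<bar>b\<bar> * \<bar>ln u\<bar>)"
      using integrable_exp_measure_abs_ln by simp
    show "\<forall>\<^sub>F x in at_top. AE u in exp_measure. norm (d (x * u)) \<le> W + \<bar>b\<bar> * \<bar>ln u\<bar>"
      using eventually_ge_at_top[of 1]
    proof eventually_elim
      case (elim x)
      show ?case
        using AE_exp_measure_pos
      proof eventually_elim
        case u: (elim u)
        have V0: "V B - V 0 \<ge> 0" using s0_bound[of 0 B] B by simp
        have W0: "0 \<le> W + \<bar>b\<bar> * \<bar>ln u\<bar>" using V0 by (simp add: W_def)
        show ?case
        proof (cases "x * u \<ge> B")
          case True
          then show ?thesis using W0 by (simp add: d_def truncated_def max_def)
        next
          case False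
          have xu: "0 < x * u" "u \<le> x * u" "x * u \<le> B" using elim u False by auto
          have "ln u \<le> ln (x * u)" "ln (x * u) \<le> ln B"
            using xu u B by (auto simp del: ln_mult_pos intro!: ln_mono)
          then have "\<bar>ln (x * u)\<bar> \<le> \<bar>ln B\<bar> + \<bar>ln u\<bar>" by linarith
          then have "\<bar>b\<bar> * \<bar>ln (x * u)\<bar> \<le> \<bar>b\<bar> * (\<bar>ln B\<bar> + \<bar>ln u\<bar>)"
            by (intro mult_left_mono) auto
          then have "\<bar>b * ln (x * u)\<bar> \<le> \<bar>b\<bar> * \<bar>ln B\<bar> + \<bar>b\<bar> * \<bar>ln u\<bar>"
            by (simp add: abs_mult distrib_left)
          moreover have "\<bar>s0 (x * u)\<bar> \<le> V B - V 0" using xu by (intro s0_bound) auto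
          moreover have "truncated c b (x * u) = truncated c b B"
            using xu by (simp add: truncated_def max_def)
          ultimately show ?thesis
            unfolding d_def W_def remainder_def real_norm_def by linarith
        qed
      qed
    qed
    show "AE u in exp_measure. ((\<lambda>x. d (x * u)) \<longlongrightarrow> 0) at_top"
      using AE_exp_measure_pos
    proof eventually_elim
      case (elim u)
      have "\<forall>\<^sub>F x in at_top. d (x * u) = 0"
        using eventually_ge_at_top[of "B / u"]
        by eventually_elim (use elim in \<open>auto simp: d_def truncated_def max_def field_simps\<close>)
      then show ?case by (rule tendsto_eventually)
    qed
  qed auto
  then have "((\<lambda>x. \<integral>u. d (x * u) \<partial>exp_measure) \<longlongrightarrow> 0) at_top" by simp
  then show ?thesis
  proof (rule Lim_transform_eventually)
    show "\<forall>\<^sub>F x in at_top. (\<integral>u. d (x * u) \<partial>exp_measure)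
        = abel_mean (remainder c b) x - abel_mean (truncated c b) x"
      using eventually_gt_at_top[of 0]
    proof eventually_elim
      case (elim x)
      then show ?case
        unfolding d_def abel_mean_def
        using integrable_remainder integrable_subexponential[OF measurable_truncated subexponential_truncated]
        by (intro Bochner_Integration.integral_diff) auto
    qed
  qed
qed

lemma abel_mean_remainder_tendsto_iff:
  "(abel_mean (remainder c b) \<longlongrightarrow> 0) at_top \<longleftrightarrow> (remainder c b \<longlongrightarrow> 0) at_top"
proof -
  interpret T: slowly_decreasing "truncated c b" "A + \<bar>b\<bar>"
    by (rule slowly_decreasing_truncated)
  have "(abel_mean (remainder c b) \<longlongrightarrow> 0) at_top \<longleftrightarrow> (abel_mean (truncated c b) \<longlongrightarrow> 0) at_top"
    using tendsto_diff[OF _ abel_mean_truncated_diff[of c b], of "abel_mean (remainder c b)" 0]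
      tendsto_add[OF _ abel_mean_truncated_diff[of c b], of "abel_mean (truncated c b)" 0] by auto
  also have "\<dots> \<longleftrightarrow> (truncated c b \<longlongrightarrow> 0) at_top"
  proof
    assume "(truncated c b \<longlongrightarrow> 0) at_top"
    then show "(abel_mean (truncated c b) \<longlongrightarrow> 0) at_top"
      using bounded_of_subexponential_tendsto_0[OF subexponential_truncated]
      by (metis abel_mean_tendsto_0 measurable_truncated)
  qed (rule T.tendsto_0_of_abel_mean)
  finally show ?thesis by (simp add: truncated_tendsto_iff)
qed

end

theorem theorem3p7:
  fixes s :: "real \<Rightarrow> real" and L :: "real \<Rightarrow> real" and a b :: real
  assumes bv: "locally_bounded_variation s"
    and neg: "\<And>x. x < 0 \<Longrightarrow> s x = 0"
    and lap: "\<And>y. y > 0 \<Longrightarrow> laplace_C s y (L y)"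
    and tauber: "\<exists>A>0. \<exists>B>0. mono_on {B..} (\<lambda>x. s x + A * ln x)"
  shows "((\<lambda>y. L y - (a + b * ln (1 / y))) \<longlongrightarrow> 0) (at_right 0) \<longleftrightarrow>
         ((\<lambda>x. s x - (s 0 + a + b * euler_mascheroni + b * ln x)) \<longlongrightarrow> 0) at_top"
proof -
  obtain V where V: "\<And>x y. x \<le> y \<Longrightarrow> \<bar>s y - s x\<bar> \<le> V y - V x"
    using locally_bounded_variation_majorant[OF bv neg] by blast
  obtain A B where AB: "A > 0" "B > 0" "mono_on {B..} (\<lambda>x. s x + A * ln x)"
    using tauber by blast
  interpret log_tauberian s V A B L
    by unfold_locales (use V AB lap in auto)
  \<comment> \<open>The Abel mean of \<open>b * ln\<close> at \<open>x\<close> is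
    \<open>b * ln x - b * euler_mascheroni\<close>; with this constant the shift cancels and leaves
    \<open>a\<close> on the Laplace side.\<close>
  let ?c = "a + b * euler_mascheroni"
  have "((\<lambda>y. L y - (a + b * ln (1 / y))) \<longlongrightarrow> 0) (at_right 0) \<longleftrightarrow>
      ((\<lambda>x. L (inverse x) - (a + b * ln (1 / inverse x))) \<longlongrightarrow> 0) at_top"
    by (rule filterlim_at_right_to_top)
  also have "\<dots> \<longleftrightarrow> (abel_mean (remainder ?c b) \<longlongrightarrow> 0) at_top"
  proof (rule filterlim_cong[OF refl refl])
    show "\<forall>\<^sub>F x in at_top. L (inverse x) - (a + b * ln (1 / inverse x)) = abel_mean (remainder ?c b) x"
      using eventually_gt_at_top[of 0]
      by eventually_elim (simp add: abel_mean_remainder inverse_eq_divide algebra_simps)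
  qed
  also have "\<dots> \<longleftrightarrow> (remainder ?c b \<longlongrightarrow> 0) at_top"
    by (rule abel_mean_remainder_tendsto_iff)
  also have "remainder ?c b = (\<lambda>x. s x - (s 0 + a + b * euler_mascheroni + b * ln x))"
    by (auto simp: remainder_def s0_def)
  finally show ?thesis .
qed

end
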